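(* Let $A\in\mathbb{R}^{n\times n}$ with $W(A)\subset\Sigma_{\vartheta,a}$ for some $a\ge0$ and $0\le\vartheta\le\pi/2$. Let $\ell\ge0$ be an integer, ${\bf y}(t)=\varphi_\ell(-tA){\bf v}$, $\widehat{\bf y}_{\ell,k}(t)=V_k\varphi_\ell(-tT_k)\beta{\bf e}_1$, let $\widehat{\bf e}_{\ell,k}(t)={\bf y}(t)-\widehat{\bf y}_{\ell,k}(t)$ be the error and $\widehat{\bf r}_{\ell,k}(t)$ the residual of the harmonic Arnoldi approximation $\widehat{\bf y}_{\ell,k}(t)$, and assume ${\bf e}_k^{\mathrm H}\varphi_\ell(-tT_k){\bf e}_1\ne0$. Let $\varepsilon>0$, and suppose that $k+k_{2}+2\ell\geq 4$, where $k_2$ is the number of real eigenvalues of $T_k$, and that $W(T_{k})\subset\Sigma_{\vartheta,a}$. Then $$ \|\widehat{\bf e}_{\ell,k}(t)\|_{2}\leq\widehat{c}_{\ell,k}\cdot\int_{0}^{\infty}\frac{(1+\rho^{2}/\varepsilon^{2})^{-\ell/2}}{\widehat{\varsigma}_{k}(\rho)}\,d\rho\cdot\|\widehat{\bf r}_{\ell,k}(t)\|_{2}, $$ where $$\widehat{c}_{\ell,k}=\frac{\exp(t\varepsilon)}{\pi(t\varepsilon)^{\ell}\,\widehat{\omega}_{k}(\varepsilon)(\varepsilon+a)}\cdot\frac{\prod_{j=1}^{k-1}h_{j+1,j}}{|{\bf e}_{k}^{\mathrm{H}}\varphi_{\ell}(-tT_{k}){\bf e}_{1}|}.$$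
   Context: The $\varphi$-functions are $\varphi_0(z)=e^z$ and $\varphi_\ell(z)=\frac{1}{(\ell-1)!}\int_0^1 e^{(1-\theta)z}\theta^{\ell-1}d\theta$ for $\ell\ge1$ (extended to square matrices as matrix functions). $t>0$, and ${\bf v}\in\mathbb R^n$ is nonzero with $\beta=\|{\bf v}\|_2$. The $k$-step Arnoldi process started with ${\bf v}_1={\bf v}/\beta$ is assumed to produce $V_{k+1}=[V_k,{\bf v}_{k+1}]$ with orthonormal columns (spanning $\mathrm{span}\{{\bf v}_1,A{\bf v}_1,\dots,A^k{\bf v}_1\}$), a real $k\times k$ upper Hessenberg matrix $H_k=(h_{i,j})$ with nonnegative subdiagonal entries, and a real scalar $h_{k+1,k}$ with $AV_k=V_kH_k+h_{k+1,k}{\bf v}_{k+1}{\bf e}_k^{\mathrm{H}}$. Here ${\bf e}_j$ is the $j$-th column of the $k\times k$ identity matrix, $(\cdot)^{\mathrm{H}}$ is the conjugate transpose, $(\cdot)^{-\mathrm{H}}$ is the inverse of the conjugate transpose, ${\bf i}^2=-1$, and $'$ denotes $d/dt$. The parameter $\gamma$ is a nonzero real number such that $I+\gamma H_k$ is nonsingular, and $$T_k=H_k+\gamma h_{k+1,k}^2(I+\gamma H_k)^{-\mathrm{H}}{\bf e}_k{\bf e}_k^{\mathrm{H}}.$$ The residual is, for $\ell\ge1$, $\widehat{\bf r}_{\ell,k}(t)=-A\widehat{\bf y}_{\ell,k}(t)-\frac{\ell}{t}\widehat{\bf y}_{\ell,k}(t)+\frac{1}{t(\ell-1)!}{\bf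 v}-\widehat{\bf y}_{\ell,k}'(t)$, and for $\ell=0$, $\widehat{\bf r}_{0,k}(t)=-A\widehat{\bf y}_{0,k}(t)-\widehat{\bf y}_{0,k}'(t)$. For a square matrix $M$, $W(M)=\{(M{\bf x},{\bf x})/({\bf x},{\bf x}):{\bf x}\ne{\bf 0}\}$ (${\bf x}$ complex) is the numerical range, with $(\cdot,\cdot)$ the Euclidean inner product, and $\Sigma_{\vartheta,a}=\{z\in\mathbb C:|\arg(z-a)|\le\vartheta\}$. Let $\widehat\mu_j=\widehat a_j+{\bf i}\widehat b_j$ ($j=1,\dots,k$) be the eigenvalues of $T_k$ (with multiplicity), ordered so that $\widehat\mu_1,\dots,\widehat\mu_{k_2}$ are the real ones and $\widehat\mu_{k_2+1},\dots,\widehat\mu_k$ are the non-real ones (complex conjugate pairs). Define $$\widehat r_j=\big((\varepsilon+\widehat a_j)^2+\widehat b_j^2\big)^{1/2},\qquad \widehat\omega_k(\varepsilon)=\prod_{j=1}^k\big(\widehat r_j(\varepsilon+\widehat a_j)\big)^{1/2},$$ $$\widehat\varsigma_k(\rho)=\prod_{j=1}^{k_2}(1+\rho^2/\widehat r_j^2)^{1/2}\prod_{j=k_2+1}^{k}(1+\rho^2/\widehat r_j^2)^{1/4}.$$ *)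

theory Defs
  imports
    "HOL-Complex_Analysis.Complex_Analysis"
    "Jordan_Normal_Form.Char_Poly"
    "Jordan_Normal_Form.Gauss_Jordan_Elimination"
    "Jordan_Normal_Form.Schur_Decomposition"
    "Jordan_Normal_Form.VS_Connect"
begin

(* Matrices and vectors are those of Jordan_Normal_Form (indices start at 0);
   the notation of the Cartesian product types of HOL-Analysis would clash with theirs. *)
no_notation vec_nth (infixl \<open>$\<close> 90)
no_notation inner (infix \<open>\<bullet>\<close> 70)
hide_const (open) Finite_Cartesian_Product.vec Finite_Cartesian_Product.mat
  Finite_Cartesian_Product.row Finite_Cartesian_Product.column Determinants.det

section \<open>The phi-functions and functions of matrices\<close>

definition phi :: "nat \<Rightarrow> 'a :: {real_normed_field, banach} \<Rightarrow> 'a" where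
  "phi l z = (if l = 0 then exp z
     else (1 / fact (l - 1)) *
       integral {0..1} (\<lambda>\<theta>::real. exp (of_real (1 - \<theta>) * z) * of_real (\<theta> ^ (l - 1))))"

(* The matrix function f(M) given by the Taylor series of f at 0, taken entrywise.
   It is only used for entire f (namely the phi-functions), where the series converges for
   every square matrix M and agrees with the other usual definitions of f(M). *)
definition matfun :: "('a :: real_normed_field \<Rightarrow> 'a) \<Rightarrow> 'a mat \<Rightarrow> 'a mat" where
  "matfun f M = mat (dim_row M) (dim_row M)
     (\<lambda>(i, j). \<Sum>m. (deriv ^^ m) f 0 / fact m * (M ^\<^sub>m m) $$ (i, j))"

section \<open>Vectors and matrices\<close>

definition norm2 :: "real vec \<Rightarrow> real" where
  "norm2 v = sqrt (v \<bullet> v)"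

definition vec_deriv :: "(real \<Rightarrow> real vec) \<Rightarrow> real \<Rightarrow> real vec" where
  "vec_deriv f t = vec (dim_vec (f t)) (\<lambda>i. deriv (\<lambda>s. f s $ i) t)"

(* The product of a column vector u with the row vector given by the conjugate transpose of w *)
definition outer_prod :: "'a :: conjugatable_field vec \<Rightarrow> 'a vec \<Rightarrow> 'a mat" where
  "outer_prod u w = mat (dim_vec u) (dim_vec w) (\<lambda>(i, j). u $ i * conjugate (w $ j))"

(* The inverse of the conjugate transpose, for a nonsingular matrix *)
definition inv_adjoint :: "'a :: conjugatable_field mat \<Rightarrow> 'a mat" where
  "inv_adjoint M = the (mat_inverse (mat_adjoint M))"

definition upper_hessenberg :: "'a :: zero mat \<Rightarrow> bool" where
  "upper_hessenberg H \<longleftrightarrow> (\<forall>i < dim_row H. \<forall>j < dim_col H. j + 1 < i \<longrightarrow> H $$ (i, j) = 0)"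

abbreviation complexify :: "real mat \<Rightarrow> complex mat" where
  "complexify \<equiv> map_mat complex_of_real"

definition numerical_range :: "complex mat \<Rightarrow> complex set" where
  "numerical_range M =
     {((M *\<^sub>v x) \<bullet>c x) / (x \<bullet>c x) | x. x \<in> carrier_vec (dim_row M) \<and> x \<noteq> 0\<^sub>v (dim_row M)}"

(* Since Arg 0 = 0, the vertex a belongs to the sector. *)
definition sector :: "real \<Rightarrow> real \<Rightarrow> complex set" where
  "sector \<theta> a = {z. \<bar>Arg (z - of_real a)\<bar> \<le> \<theta>}"

section \<open>The Arnoldi decomposition and its harmonic modification\<close>

abbreviation span_vec :: "nat \<Rightarrow> real vec set \<Rightarrow> real vec set" where
  "span_vec n \<equiv> LinearCombinations.module.span class_ring (module_vec TYPE(real) n)"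

(* What k steps of the Arnoldi process started with v / norm2 v produce: V is V_k, w is the
   last column v_{k+1} of V_{k+1} = [V_k, v_{k+1}], H is H_k and h is h_{k+1,k}. *)
definition arnoldi :: "nat \<Rightarrow> real mat \<Rightarrow> real vec \<Rightarrow> nat \<Rightarrow> real mat \<Rightarrow> real vec \<Rightarrow> real mat \<Rightarrow> real \<Rightarrow> bool"
  where
  "arnoldi n A v k V w H h \<longleftrightarrow>
     (let v1 = (1 / norm2 v) \<cdot>\<^sub>v v; V' = mat_of_cols n (cols V @ [w]) in
       1 \<le> k \<and> V \<in> carrier_mat n k \<and> w \<in> carrier_vec n \<and> H \<in> carrier_mat k k \<and>
       col V 0 = v1 \<and>
       mat_adjoint V' * V' = 1\<^sub>m (k + 1) \<and>
       span_vec n (set (cols V')) = span_vec n ((\<lambda>j. (A ^\<^sub>m j) *\<^sub>v v1) ` {0..k}) \<and>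
       upper_hessenberg H \<and>
       (\<forall>j < k - 1. 0 \<le> H $$ (j + 1, j)) \<and>
       A * V = V * H + h \<cdot>\<^sub>m outer_prod w (unit_vec k (k - 1)))"

definition harmonic_mat :: "nat \<Rightarrow> real mat \<Rightarrow> real \<Rightarrow> real \<Rightarrow> real mat" where
  "harmonic_mat k H h \<gamma> =
     H + (\<gamma> * h\<^sup>2) \<cdot>\<^sub>m
       (inv_adjoint (1\<^sub>m k + \<gamma> \<cdot>\<^sub>m H) * outer_prod (unit_vec k (k - 1)) (unit_vec k (k - 1)))"

definition residual :: "real mat \<Rightarrow> real vec \<Rightarrow> nat \<Rightarrow> (real \<Rightarrow> real vec) \<Rightarrow> real \<Rightarrow> real vec" where
  "residual A v l y t =
     (if l = 0 then - (A *\<^sub>v y t) - vec_deriv y t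
      else - (A *\<^sub>v y t) - (real l / t) \<cdot>\<^sub>v y t + (1 / (t * fact (l - 1))) \<cdot>\<^sub>v v - vec_deriv y t)"

section \<open>Quantities built from the eigenvalues\<close>

definition r_hat :: "(nat \<Rightarrow> complex) \<Rightarrow> real \<Rightarrow> nat \<Rightarrow> real" where
  "r_hat \<mu> \<epsilon> j = sqrt ((\<epsilon> + Re (\<mu> j))\<^sup>2 + (Im (\<mu> j))\<^sup>2)"

definition omega_hat :: "nat \<Rightarrow> (nat \<Rightarrow> complex) \<Rightarrow> real \<Rightarrow> real" where
  "omega_hat k \<mu> \<epsilon> = (\<Prod>j<k. sqrt (r_hat \<mu> \<epsilon> j * (\<epsilon> + Re (\<mu> j))))"

definition sigma_hat :: "nat \<Rightarrow> nat \<Rightarrow> (nat \<Rightarrow> complex) \<Rightarrow> real \<Rightarrow> real \<Rightarrow> real" where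
  "sigma_hat k k2 \<mu> \<epsilon> \<rho> =
     (\<Prod>j<k2. (1 + \<rho>\<^sup>2 / (r_hat \<mu> \<epsilon> j)\<^sup>2) powr (1/2)) *
     (\<Prod>j=k2..<k. (1 + \<rho>\<^sup>2 / (r_hat \<mu> \<epsilon> j)\<^sup>2) powr (1/4))"

end

theory Submission
  imports Defs "HOL-Real_Asymp.Real_Asymp"
begin

text \<open>
  With u = h w - V g, where g is the correction vector in T = H + g e_k^T, the Arnoldi relation becomes
  A V = V T + u e_k^T, and the residual is the multiple - beta (e_k^T phi_l(-tT) e_1) u of u. On the level of
  resolvents the same relation gives
  (z + A)^{-1} v - beta V (z + T)^{-1} e_1 = - beta (z + A)^{-1} u (e_k^T (z + T)^{-1} e_1),
  and since T is upper Hessenberg the last factor is, up to sign, the product of the subdiagonal entries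
  divided by det(z + T). The error, tested against a fixed vector, is t^{-l} / (2 pi i) times the integral of
  exp(tz) z^{-l} times this difference over a large circle around eps, as one sees by integrating the Neumann
  series term by term. All singularities lie in the closed left half-plane and the difference decays at
  least quadratically, so the circle can be replaced by the vertical line Re z = eps. There the numerical
  range bounds the resolvent of A by 1 / (eps + a), and |det(z + T)| is bounded below by pairing each
  eigenvalue with its complex conjugate. Testing against the error vector itself gives the claim.
\<close>

text \<open>Each of the two terms in the difference of resolvents is only O(1/|z|), which for l = 0
  does not make an arc of length pi R negligible. The rank-one form of A V - V T turns the
  difference into a product of two resolvents, and this gains the second power. The shape of the
  bound is read off the line Re z = eps: exp(t eps) / (t eps)^l comes from exp(tz) / z^l and from
  the prefactor t^(-l), and eps > 0 keeps the pole at 0 to the left. In the estimate of det(z + T) a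
  real eigenvalue contributes a full power of rho, a non-real one only half a power, since Im z may
  cancel its imaginary part. The integrand therefore decays like (1 + rho^2)^(-(k + k2 + 2l)/4), and
  k + k2 + 2l >= 4 makes 1 / (1 + rho^2) a majorant up to a constant. The estimate on the line
  contains beta ||u||, while the residual has norm beta |e_k^T phi_l(-tT) e_1| ||u||; eliminating
  beta ||u|| puts e_k^T phi_l(-tT) e_1 into the denominator of the constant.\<close>

section \<open>The phi-functions of a matrix\<close>

text \<open>Termwise differentiation transforms the coefficients by \<open>diffs\<close>, and at 0
  only the constant term survives. Since \<open>matfun\<close> is defined through derivatives at 0,
  this is what lets the known coefficients of \<open>phi l\<close> enter.\<close>

lemma higher_deriv_power_series_0:
  fixes f :: "'a::{real_normed_field,banach} \<Rightarrow> 'a"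
  assumes "\<And>x. (\<lambda>n. c n * x ^ n) sums f x"
  shows "(deriv ^^ m) f 0 = fact m * c m"
proof -
  have "(\<lambda>n. (diffs ^^ m) c n * x ^ n) sums (deriv ^^ m) f x" for x
  proof (induction m arbitrary: x)
    case (Suc m)
    have eq: "(deriv ^^ m) f = (\<lambda>x. \<Sum>n. (diffs ^^ m) c n * x ^ n)"
      using Suc by (simp add: sums_iff fun_eq_iff)
    have smb: "summable (\<lambda>n. (diffs ^^ m) c n * x ^ n)" for x
      using Suc sums_summable by blast
    have "((deriv ^^ m) f has_field_derivative (\<Sum>n. diffs ((diffs ^^ m) c) n * x ^ n)) (at x)"
      unfolding eq by (rule termdiffs_strong_converges_everywhere [OF smb])
    moreover have "summable (\<lambda>n. diffs ((diffs ^^ m) c) n * x ^ n)"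
      by (rule termdiff_converges_all [OF smb])
    ultimately show ?case by (simp add: DERIV_imp_deriv summable_sums)
  qed (use assms in simp)
  from this [of 0] have "(deriv ^^ m) f 0 = (diffs ^^ m) c 0"
    using powser_sums_zero_iff sums_unique2 by metis
  also have "(diffs ^^ m) c n = fact (m + n) / fact n * c (m + n)" for n
  proof (induction m arbitrary: n)
    case (Suc m)
    have "(diffs ^^ Suc m) c n = of_nat (Suc n) * (diffs ^^ m) c (Suc n)"
      by (simp add: diffs_def)
    also have "\<dots> = fact (Suc m + n) / fact n * c (Suc m + n)"
      unfolding Suc fact_Suc [of n] by (simp add: field_simps del: of_nat_Suc)
    finally show ?case .
  qed simp
  from this [of 0] have "(diffs ^^ m) c 0 = fact m * c m" by simp
  finally show ?thesis .
qed

text \<open>The Beta integral B(p + 1, m + 1) at integer arguments; it produces the Taylor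
  coefficients of \<open>phi l\<close>.\<close>

lemma has_integral_power_mult_power:
  "((\<lambda>x::real. (1 - x) ^ m * x ^ p) has_integral fact m * fact p / fact (m + p + 1)) {0..1}"
proof -
  \<comment> \<open>The open interval matters: \<open>0 powr 0\<close> is 0 but \<open>0 ^ 0\<close>
    is 1, so the two kinds of powers may differ at the endpoints.\<close>
  have "((\<lambda>t::real. t powr (real p + 1 - 1) * (1 - t) powr (real m + 1 - 1))
      has_integral Beta (real p + 1) (real m + 1)) {0<..<1}"
    using has_integral_Beta_real [of "real p + 1" "real m + 1"]
    by (simp add: has_integral_Icc_iff_Ioo)
  moreover have "Beta (real p + 1) (real m + 1) = fact m * fact p / fact (m + p + 1)"
    using Gamma_fact [of p, where 'a = real] Gamma_fact [of m, where 'a = real]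
      Gamma_fact [of "m + p + 1", where 'a = real]
    by (simp add: Beta_def add_ac)
  ultimately have "((\<lambda>x::real. (1 - x) ^ m * x ^ p)
      has_integral fact m * fact p / fact (m + p + 1)) {0<..<1}"
    by (subst has_integral_cong) (auto simp: powr_realpow)
  then show ?thesis by (simp add: has_integral_Icc_iff_Ioo)
qed

text \<open>Expand the exponential under the integral and integrate termwise; the majorant |x|^m /
  m! is uniform in the integration variable. With p = l - 1, the Beta value divided by m! p! is 1 /
  (m + l)!.\<close>

lemma phi_sums: "(\<lambda>m. x ^ m / fact (m + l)) sums phi l (x :: real)"
proof (cases l)
  case 0
  then show ?thesis using exp_converges [of x] by (simp add: phi_def field_simps)
next
  case (Suc p)
  define f where "f = (\<lambda>N \<theta>. \<Sum>m<N. ((1 - \<theta>) * x) ^ m / fact m * \<theta> ^ p)"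
  have "uniform_limit {0..1} (\<lambda>N \<theta>. \<Sum>m<N. ((1 - \<theta>) * x) ^ m / fact m * \<theta> ^ p)
      (\<lambda>\<theta>. \<Sum>m. ((1 - \<theta>) * x) ^ m / fact m * \<theta> ^ p) sequentially"
  proof (rule Weierstrass_m_test)
    show "summable (\<lambda>m. \<bar>x\<bar> ^ m / fact m)"
      using summable_exp [of "\<bar>x\<bar>"] by (simp add: field_simps)
    fix m :: nat and \<theta> :: real assume \<theta>: "\<theta> \<in> {0..1}"
    have "((1 - \<theta>) * \<bar>x\<bar>) ^ m \<le> \<bar>x\<bar> ^ m" "\<theta> ^ p \<le> 1"
      using \<theta> by (auto intro!: power_mono mult_left_le_one_le power_le_one)
    then have "((1 - \<theta>) * \<bar>x\<bar>) ^ m / fact m * \<theta> ^ p \<le> \<bar>x\<bar> ^ m / fact m * 1"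
      using \<theta> by (intro mult_mono divide_right_mono) auto
    then show "norm (((1 - \<theta>) * x) ^ m / fact m * \<theta> ^ p) \<le> \<bar>x\<bar> ^ m / fact m"
      using \<theta> by (simp add: abs_mult power_abs)
  qed
  moreover have "(\<Sum>m. ((1 - \<theta>) * x) ^ m / fact m * \<theta> ^ p) = exp ((1 - \<theta>) * x) * \<theta> ^ p" for \<theta>
    using sums_mult2 [OF exp_converges [of "(1 - \<theta>) * x"], of "\<theta> ^ p"]
    by (intro sums_unique [symmetric]) (simp add: field_simps)
  ultimately have lim: "uniform_limit {0..1} f (\<lambda>\<theta>. exp ((1 - \<theta>) * x) * \<theta> ^ p) sequentially"
    by (simp add: f_def)
  obtain I J where I: "\<And>N. (f N has_integral I N) {0..1}"
    and J: "((\<lambda>\<theta>. exp ((1 - \<theta>) * x) * \<theta> ^ p) has_integral J) {0..1}" and IJ: "I \<longlonglongrightarrow> J"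
    by (rule uniform_limit_integral [OF lim]) (auto simp: f_def intro!: continuous_intros)
  have "(f N has_integral (\<Sum>m<N. x ^ m / fact m * (fact m * fact p / fact (m + p + 1)))) {0..1}" for N
  proof -
    have "f N = (\<lambda>\<theta>. \<Sum>m<N. x ^ m / fact m * ((1 - \<theta>) ^ m * \<theta> ^ p))"
      by (simp add: f_def power_mult_distrib mult_ac)
    then show ?thesis
      by (simp only:) (intro has_integral_sum has_integral_mult_right has_integral_power_mult_power; simp)
  qed
  then have "I = (\<lambda>N. \<Sum>m<N. x ^ m / fact m * (fact m * fact p / fact (m + p + 1)))"
    using I has_integral_unique by blast
  then have "(\<lambda>m. x ^ m / fact m * (fact m * fact p / fact (m + p + 1))) sums J"
    using IJ by (simp only: sums_def)
  from sums_mult [OF this, of "1 / fact p"] have "(\<lambda>m. x ^ m / fact (m + l)) sums (J / fact p)"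
    using Suc by (simp add: field_simps)
  also have "J / fact p = phi l x"
    using J Suc by (simp add: phi_def integral_unique)
  finally show ?thesis .
qed

section \<open>Entries of the phi-functions of a matrix and their differential equation in
  time\<close>

lemma matfun_phi_index:
  fixes M :: "real mat"
  assumes "M \<in> carrier_mat n n" "i < n" "j < n"
  shows "matfun (phi l) M $$ (i, j) = (\<Sum>m. (M ^\<^sub>m m) $$ (i, j) / fact (m + l))"
proof -
  have "(deriv ^^ m) (phi l) (0 :: real) = fact m * (1 / fact (m + l))" for m
    using phi_sums [of _ l] by (intro higher_deriv_power_series_0) simp
  then show ?thesis using assms by (simp add: matfun_def)
qed

lemma pow_mat_Suc_left:
  assumes "M \<in> carrier_mat n n"
  shows "M ^\<^sub>m Suc m = M * M ^\<^sub>m m"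
  using assms
proof (induction m)
  case (Suc m)
  then show ?case using assoc_mult_mat [of M n n "M ^\<^sub>m m" n M n] by auto
qed auto

lemma pow_mat_smult:
  assumes "M \<in> carrier_mat n n"
  shows "(c \<cdot>\<^sub>m M) ^\<^sub>m m = c ^ m \<cdot>\<^sub>m (M ^\<^sub>m m :: 'a :: comm_semiring_1 mat)"
proof (induction m)
  case 0
  show ?case using assms by (auto intro!: eq_matI)
next
  case (Suc m)
  show ?case using assms
    by (intro eq_matI)
      (auto simp: Suc scalar_prod_def sum_distrib_left mult_ac intro!: sum.cong)
qed

text \<open>Geometric growth of the powers drives the convergence of both the Taylor and the Neumann
  series. Multiplication by \<open>M\<close> costs at most n times the sum \<open>K\<close> of the
  moduli of all entries; the added 1 keeps the base positive even for the zero matrix.\<close>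

lemma pow_mat_index_bound:
  fixes M :: "'a :: real_normed_field mat"
  assumes M: "M \<in> carrier_mat n n"
  obtains B where "B > 0" "\<And>m i j. i < n \<Longrightarrow> j < n \<Longrightarrow> norm ((M ^\<^sub>m m) $$ (i, j)) \<le> B ^ m"
proof
  define K where "K = (\<Sum>i<n. \<Sum>j<n. norm (M $$ (i, j)))"
  have K0: "K \<ge> 0" by (simp add: K_def sum_nonneg)
  have K: "norm (M $$ (i, j)) \<le> K" if "i < n" "j < n" for i j
  proof -
    have "norm (M $$ (i, j)) \<le> (\<Sum>j<n. norm (M $$ (i, j)))"
      using that by (intro member_le_sum) auto
    also have "\<dots> \<le> K"
      unfolding K_def using that
      by (intro member_le_sum [of i _ "\<lambda>i. \<Sum>j<n. norm (M $$ (i, j))"]) (auto intro: sum_nonneg)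
    finally show ?thesis .
  qed
  show "real n * K + 1 > 0" using K0 by (simp add: add_nonneg_pos)
  show "norm ((M ^\<^sub>m m) $$ (i, j)) \<le> (real n * K + 1) ^ m" if "i < n" "j < n" for m i j
    using that
  proof (induction m arbitrary: i j)
    case (Suc m)
    have "norm ((M ^\<^sub>m Suc m) $$ (i, j)) = norm (\<Sum>k<n. (M ^\<^sub>m m) $$ (i, k) * M $$ (k, j))"
      using M Suc by (auto simp: scalar_prod_def atLeast0LessThan)
    also have "\<dots> \<le> (\<Sum>k<n. (real n * K + 1) ^ m * K)"
      using M K K0 Suc by (intro sum_norm_le) (auto simp: norm_mult intro!: mult_mono)
    also have "\<dots> = (real n * K + 1) ^ m * (real n * K)" by simp
    also have "\<dots> \<le> (real n * K + 1) ^ m * (real n * K + 1)"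
      using K0 by (intro mult_left_mono) auto
    finally show ?case by (simp only: power_Suc2)
  qed (use M in auto)
qed

lemma summable_phi_coeffs:
  fixes M :: "real mat"
  assumes "M \<in> carrier_mat n n" "i < n" "j < n"
  shows "summable (\<lambda>m. (-1) ^ m * (M ^\<^sub>m m) $$ (i, j) / fact (m + l) * s ^ m)"
proof -
  obtain B where B: "B > 0" "\<And>m i j. i < n \<Longrightarrow> j < n \<Longrightarrow> norm ((M ^\<^sub>m m) $$ (i, j)) \<le> B ^ m"
    using pow_mat_index_bound assms by blast
  show ?thesis
  proof (rule summable_comparison_test' [where N = 0])
    show "summable (\<lambda>m. (B * \<bar>s\<bar>) ^ m / fact m)"
      using summable_exp [of "B * \<bar>s\<bar>"] by (simp add: field_simps)
    fix m
    have "\<bar>(M ^\<^sub>m m) $$ (i, j)\<bar> * \<bar>s\<bar> ^ m / fact (m + l) \<le> B ^ m * \<bar>s\<bar> ^ m / fact m"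
      using B assms by (intro frac_le mult_mono fact_mono) auto
    then show "norm ((-1) ^ m * (M ^\<^sub>m m) $$ (i, j) / fact (m + l) * s ^ m) \<le> (B * \<bar>s\<bar>) ^ m / fact m"
      by (simp add: abs_mult power_abs power_mult_distrib)
  qed
qed

lemma matfun_phi_sums:
  fixes M :: "real mat"
  assumes "M \<in> carrier_mat n n" "i < n" "j < n"
  shows "(\<lambda>m. (-1) ^ m * (M ^\<^sub>m m) $$ (i, j) / fact (m + l) * s ^ m) sums
    matfun (phi l) ((- s) \<cdot>\<^sub>m M) $$ (i, j)"
proof -
  have "(((- s) \<cdot>\<^sub>m M) ^\<^sub>m m) $$ (i, j) / fact (m + l) =
      (-1) ^ m * (M ^\<^sub>m m) $$ (i, j) / fact (m + l) * s ^ m" for m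
    using assms power_minus [of s m] by (simp add: pow_mat_smult)
  then show ?thesis
    using summable_sums [OF summable_phi_coeffs [OF assms]] assms
    by (simp add: matfun_phi_index [where n = n])
qed

text \<open>Multiplying the derivative by s turns each coefficient c_m into m c_m, and (m + 1 + l)
  c_(m+1) = - M c_m. Hence s f' + l f agrees with - s M f except for the constant term l c_0. That
  term is the inhomogeneity: it is zero for l = 0, and otherwise l / l! = 1 / (l - 1)!.\<close>

lemma has_deriv_matfun_phi:
  fixes M :: "real mat" and l :: nat and s :: real
  assumes M: "M \<in> carrier_mat n n" "i < n" "j < n" and s: "s \<noteq> 0"
  defines "f \<equiv> \<lambda>i s. matfun (phi l) ((- s) \<cdot>\<^sub>m M) $$ (i, j)"
  shows "(f i has_field_derivative
    (if l = 0 then 0 else (if i = j then 1 else 0) / (s * fact (l - 1)))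
      - (\<Sum>k<n. M $$ (i, k) * f k s) - real l / s * f i s) (at s)"
proof -
  define c where "c = (\<lambda>i m. (-1) ^ m * (M ^\<^sub>m m) $$ (i, j) / fact (m + l))"
  have sums: "(\<lambda>m. c i m * s ^ m) sums f i s" if "i < n" for i s
    unfolding c_def f_def using matfun_phi_sums M that by blast
  then have f_eq: "f i = (\<lambda>s. \<Sum>m. c i m * s ^ m)"
    using M by (auto simp: sums_iff)
  have smb: "summable (\<lambda>m. c i m * s ^ m)" for s using sums M sums_summable by blast
  define D where "D = (\<Sum>m. diffs (c i) m * s ^ m)"
  have D: "(f i has_field_derivative D) (at s)"
    unfolding f_eq D_def by (rule termdiffs_strong_converges_everywhere [OF smb])
  have smbd: "summable (\<lambda>m. diffs (c i) m * s ^ m)"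
    by (rule termdiff_converges_all [OF smb])
  have "(\<lambda>m. of_nat m * c i m * s ^ (m - Suc 0)) sums D"
    unfolding D_def by (rule diffs_equiv [OF smbd])
  from sums_mult [OF this, of s] have "(\<lambda>m. of_nat m * c i m * s ^ m) sums (s * D)"
    by (rule sums_cong [THEN iffD1, rotated]) (auto simp: power_eq_if)
  from sums_add [OF this sums_mult [OF sums [OF M(2)], of "real l" s]]
  have "(\<lambda>m. (of_nat m + real l) * c i m * s ^ m) sums (s * D + real l * f i s)"
    by (simp add: algebra_simps)
  then have 1: "(\<lambda>m. (of_nat (Suc m) + real l) * c i (Suc m) * s ^ Suc m) sums
      (s * D + real l * f i s - real l * c i 0)"
    by (subst sums_Suc_iff) simp
  have "(\<lambda>m. - s * (\<Sum>k<n. M $$ (i, k) * (c k m * s ^ m))) sums (- s * (\<Sum>k<n. M $$ (i, k) * f k s))"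
    using sums by (intro sums_mult sums_sum) auto
  also have "(\<lambda>m. - s * (\<Sum>k<n. M $$ (i, k) * (c k m * s ^ m))) =
      (\<lambda>m. (of_nat (Suc m) + real l) * c i (Suc m) * s ^ Suc m)"
  proof
    fix m
    have "(M ^\<^sub>m Suc m) $$ (i, j) = (\<Sum>k<n. M $$ (i, k) * (M ^\<^sub>m m) $$ (k, j))"
      using M by (subst pow_mat_Suc_left) (auto simp: scalar_prod_def atLeast0LessThan)
    moreover have "(of_nat (Suc m) + real l) * c i (Suc m) =
        - ((-1) ^ m * (M ^\<^sub>m Suc m) $$ (i, j) / fact (m + l))"
    proof -
      have "(fact (Suc m + l) :: real) = (of_nat (Suc m) + real l) * fact (m + l)"
        by simp
      moreover have "of_nat (Suc m) + real l \<noteq> 0" by linarith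
      ultimately show ?thesis unfolding c_def by (simp del: pow_mat.simps of_nat_Suc fact_Suc)
    qed
    ultimately show "- s * (\<Sum>k<n. M $$ (i, k) * (c k m * s ^ m)) =
        (of_nat (Suc m) + real l) * c i (Suc m) * s ^ Suc m"
      by (simp add: c_def sum_distrib_left sum_distrib_right sum_divide_distrib mult_ac sum_negf
          del: pow_mat.simps of_nat_Suc)
  qed
  finally have "s * D + real l * f i s - real l * c i 0 = - s * (\<Sum>k<n. M $$ (i, k) * f k s)"
    using 1 sums_unique2 by blast
  moreover have "real l * c i 0 = (if l = 0 then 0 else (if i = j then 1 else 0) / fact (l - 1))"
    using M by (cases l) (auto simp: c_def)
  ultimately have "D = (if l = 0 then 0 else (if i = j then 1 else 0) / (s * fact (l - 1)))
      - (\<Sum>k<n. M $$ (i, k) * f k s) - real l / s * f i s"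
    using s by (simp add: field_simps)
  with D show ?thesis by simp
qed

section \<open>From circles to a vertical line\<close>

lemma has_integral_inverse_1_plus_square: "((\<lambda>x::real. 1 / (1 + x\<^sup>2)) has_integral pi / 2) {0..}"
proof (rule has_integral_to_inf)
  have nz: "1 + x\<^sup>2 \<noteq> 0" for x :: real
    using add_pos_nonneg [of 1 "x\<^sup>2"] by simp
  then show "(\<lambda>x::real. 1 / (1 + x\<^sup>2)) integrable_on {0..y}" for y
    by (intro integrable_continuous_real continuous_intros) auto
  have "integral {0..y} (\<lambda>x. 1 / (1 + x\<^sup>2)) = arctan y" if "0 \<le> y" for y :: real
  proof -
    have "((\<lambda>x. 1 / (1 + x\<^sup>2)) has_integral arctan y - arctan 0) {0..y}"
      using that DERIV_arctan
      by (intro fundamental_theorem_of_calculus)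
        (auto simp: has_real_derivative_iff_has_vector_derivative [symmetric] inverse_eq_divide
          intro: has_field_derivative_at_within)
    then show ?thesis by (simp add: integral_unique)
  qed
  then have "\<forall>\<^sub>F y in at_top. integral {0..y} (\<lambda>x::real. 1 / (1 + x\<^sup>2)) = arctan y"
    by (auto simp: eventually_at_top_linorder)
  then show "((\<lambda>y. integral {0..y} (\<lambda>x::real. 1 / (1 + x\<^sup>2))) \<longlongrightarrow> pi / 2) at_top"
    using tendsto_arctan_at_top by (simp add: tendsto_cong)
qed simp

text \<open>The right half of the circle lies in a convex domain of holomorphy, so a primitive
  replaces it by the vertical chord between its ends. The left half has length pi R and carries an
  integrand of order 1 / R^2. Singularities on the left are never touched, because the value
  \<open>I\<close> of the circle integrals is given. The factor 2 counts the upper and the lower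
  half of the line.\<close>

lemma circle_integral_le_vertical_line:
  fixes f :: "complex \<Rightarrow> complex" and g :: "real \<Rightarrow> real"
  assumes e: "0 < e" and hol: "f holomorphic_on {z. 0 < Re z}"
    and circle: "\<forall>\<^sub>F R in at_top. (f has_contour_integral I) (circlepath (of_real e) R)"
    and decay: "\<And>z. R0 \<le> norm z \<Longrightarrow> Re z \<le> e \<Longrightarrow> norm (f z) \<le> C / norm z ^ 2" and C: "0 \<le> C"
    and line: "\<And>y. norm (f (Complex e y)) \<le> g \<bar>y\<bar>"
    and g: "g integrable_on {0..}"
  shows "norm I \<le> 2 * integral {0..} g"
proof -
  have g0: "g y \<ge> 0" if "y \<ge> 0" for y
    using order_trans [OF norm_ge_zero line [of y]] that by simp
  obtain F where F: "\<And>z. z \<in> {z. 0 < Re z} \<Longrightarrow> (F has_field_derivative f z) (at z within {z. 0 < Re z})"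
    using holomorphic_convex_primitive' [OF _ _ hol]
    by (auto simp: open_halfspace_Re_gt convex_halfspace_Re_gt)
  have prim: "(f has_contour_integral (F (pathfinish p) - F (pathstart p))) p"
    if "valid_path p" "path_image p \<subseteq> {z. 0 < Re z}" for p
    using contour_integral_primitive [OF F] that by blast
  have bound: "norm I \<le> 2 * integral {0..} g + C / (R - e) ^ 2 * R * pi"
    if R: "R > 0" "R > e" "R - e \<ge> R0"
      and I: "(f has_contour_integral I) (circlepath (of_real e) R)" for R
  proof -
    let ?q = "\<lambda>t. f (of_real e + R * cis t) * R * \<i> * cis t"
    have q: "(?q has_integral I) {0..2*pi}"
      using I by (simp add: circlepath_def has_contour_integral_part_circlepath_iff)
    then have qi: "?q integrable_on {0..2*pi}" by blast
    have qi1: "?q integrable_on {a..b}" if "0 \<le> a" "b \<le> 2 * pi" for a b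
      using integrable_subinterval_real [OF qi] that by auto
    have right: "integral {a..b} ?q = F (of_real e + R * cis b) - F (of_real e + R * cis a)"
      if "a < b" and cos: "\<And>t. t \<in> {a..b} \<Longrightarrow> cos t \<ge> 0" for a b
    proof -
      have "path_image (part_circlepath (of_real e) R a b) \<subseteq> {z. 0 < Re z}"
        using that e R by (auto simp: path_image_part_circlepath cis_conv_exp [symmetric] intro!: add_pos_nonneg)
      from prim [OF _ this] have "(f has_contour_integral
          F (of_real e + R * cis b) - F (of_real e + R * cis a)) (part_circlepath (of_real e) R a b)"
        by (simp add: cis_conv_exp)
      then show ?thesis
        using \<open>a < b\<close> by (simp add: has_contour_integral_part_circlepath_iff integral_unique)
    qed
    have "I = integral {0..2*pi} ?q" using q by (simp add: integral_unique)
    \<comment> \<open>The parametrization starts at angle 0, in the middle of the right arc, which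
      therefore comes in two pieces; the values of \<open>F\<close> at the angles 0 and 2 pi
      cancel.\<close>
    also have "\<dots> = integral {0..pi/2} ?q + integral {pi/2..2*pi} ?q"
      using qi by (intro Henstock_Kurzweil_Integration.integral_combine [symmetric]) auto
    also have "integral {pi/2..2*pi} ?q = integral {pi/2..3*pi/2} ?q + integral {3*pi/2..2*pi} ?q"
      using qi1 by (intro Henstock_Kurzweil_Integration.integral_combine [symmetric]) auto
    also have "integral {0..pi/2} ?q = F (of_real e + R * cis (pi/2)) - F (of_real e + R * cis 0)"
      by (rule right) (auto intro!: cos_ge_zero)
    also have "integral {3*pi/2..2*pi} ?q =
        F (of_real e + R * cis (2*pi)) - F (of_real e + R * cis (3*pi/2))"
    proof (rule right)
      fix t assume "t \<in> {3*pi/2..2*pi}"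
      then have "cos (2 * pi - t) \<ge> 0" by (intro cos_ge_zero) auto
      then show "cos t \<ge> 0" by (simp add: cos_diff)
    qed auto
    finally have I_eq: "I = (F (of_real e + R * cis (pi/2)) - F (of_real e + R * cis (3*pi/2)))
        + integral {pi/2..3*pi/2} ?q"
      unfolding cis_2pi cis_zero by (simp add: algebra_simps)
    have "cis (3*pi/2) = cis pi * cis (pi/2)" by (simp only: cis_mult) (simp add: field_simps)
    then have ends: "of_real e + R * cis (pi/2) = Complex e R" "of_real e + R * cis (3*pi/2) = Complex e (- R)"
      by (auto simp: complex_eq_iff)
    note I_eq = I_eq [unfolded ends]
    have "norm (integral {pi/2..3*pi/2} ?q) \<le> C / (R - e) ^ 2 * R * \<bar>3*pi/2 - pi/2\<bar>"
    proof -
      have "norm (contour_integral (part_circlepath (of_real e) R (pi/2) (3*pi/2)) f)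
          \<le> C / (R - e) ^ 2 * R * \<bar>3*pi/2 - pi/2\<bar>"
      proof (rule contour_integral_bound_part_circlepath)
        show "f contour_integrable_on part_circlepath (of_real e) R (pi/2) (3*pi/2)"
          using qi1 by (simp add: contour_integrable_part_circlepath_iff)
        fix z assume "z \<in> path_image (part_circlepath (of_real e) R (pi/2) (3*pi/2))"
        then obtain t where t: "z = of_real e + R * cis t" "pi/2 \<le> t" "t \<le> 3*pi/2"
          by (auto simp: path_image_part_circlepath cis_conv_exp)
        have "cos (t - pi) \<ge> 0" using t by (intro cos_ge_zero) auto
        then have "Re z \<le> e" using t R by (simp add: cos_diff mult_nonneg_nonpos)
        moreover have nz: "norm z \<ge> R - e"
        proof -
          have "R = norm (z - of_real e)" using t R by (simp add: norm_mult)
          also have "\<dots> \<le> norm z + e"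
            using norm_triangle_ineq4 [of z "of_real e"] e by simp
          finally show ?thesis by simp
        qed
        ultimately have "norm (f z) \<le> C / norm z ^ 2" using R by (intro decay) auto
        also have "\<dots> \<le> C / (R - e) ^ 2"
          using nz R C by (intro divide_left_mono power_mono mult_pos_pos) auto
        finally show "norm (f z) \<le> C / (R - e) ^ 2" .
      qed (use C R in auto)
      then show ?thesis by (simp add: contour_integral_part_circlepath_eq)
    qed
    moreover have "norm (F (Complex e R) - F (Complex e (- R))) \<le> 2 * integral {0..} g"
    proof -
      have img: "path_image (linepath (Complex e (- R)) (Complex e R)) \<subseteq> {z. 0 < Re z}"
        using e closed_segment_subset [OF _ _ convex_halfspace_Re_gt, of "Complex e (- R)" 0 "Complex e R"] by auto
      let ?h = "\<lambda>y. f (Complex e y)"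
      from prim [OF _ img] have h: "(?h has_integral (-\<i> * (F (Complex e R) - F (Complex e (- R))))) {- R..R}"
        using R by (subst has_contour_integral_linepath_same_Re_iff [symmetric]) auto
      then have hi: "?h integrable_on {- R..R}" by blast
      have hi1: "?h integrable_on {a..b}" if "- R \<le> a" "b \<le> R" for a b
        using integrable_subinterval_real [OF hi] that by auto
      have gm: "norm (?h (- y)) \<le> g y" "norm (?h y) \<le> g y" if "0 \<le> y" for y
        using line [of y] line [of "- y"] that by auto
      have gi: "g integrable_on {0..R}"
        by (rule integrable_on_subinterval [OF g]) auto
      have "norm (F (Complex e R) - F (Complex e (- R))) = norm (integral {- R..R} ?h)"
        using h by (simp add: integral_unique norm_mult)
      also have "integral {- R..R} ?h = integral {- R..0} ?h + integral {0..R} ?h"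
        using hi R by (intro Henstock_Kurzweil_Integration.integral_combine [symmetric]) auto
      also have "integral {- R..0} ?h = integral {0..R} (\<lambda>y. ?h (- y))"
        using Henstock_Kurzweil_Integration.integral_reflect_real [of R 0 "\<lambda>y. ?h (- y)"] by simp
      also have "norm (integral {0..R} (\<lambda>y. ?h (- y)) + integral {0..R} ?h) \<le>
          integral {0..R} g + integral {0..R} g"
      proof (intro norm_triangle_mono integral_norm_bound_integral gi)
        have "?h integrable_on {- R..- 0}" using R by (simp add: hi1)
        then show "(\<lambda>y. ?h (- y)) integrable_on {0..R}"
          using Henstock_Kurzweil_Integration.integrable_reflect_real [of "\<lambda>y. ?h (- y)" R 0] by simp
        show "?h integrable_on {0..R}" using R by (intro hi1) auto
      qed (use gm in auto)
      also have "integral {0..R} g \<le> integral {0..} g"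
        using g0 by (intro integral_subset_le gi g) auto
      finally show ?thesis by simp
    qed
    ultimately show ?thesis
      unfolding I_eq by (intro order_trans [OF norm_triangle_ineq]) (simp add: field_simps)
  qed
  have "((\<lambda>R. C * (R / (R - e) ^ 2) * pi) \<longlongrightarrow> C * 0 * pi) at_top"
    by (intro tendsto_intros) real_asymp
  from tendsto_add [OF tendsto_const this, of "2 * integral {0..} g"]
  have "((\<lambda>R. 2 * integral {0..} g + C / (R - e) ^ 2 * R * pi) \<longlongrightarrow> 2 * integral {0..} g) at_top"
    by simp
  moreover have "\<forall>\<^sub>F R in at_top. norm I \<le> 2 * integral {0..} g + C / (R - e) ^ 2 * R * pi"
    using circle eventually_gt_at_top [of 0] eventually_gt_at_top [of e] eventually_ge_at_top [of "R0 + e"]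
    by eventually_elim (intro bound, auto)
  ultimately show ?thesis
    by (intro tendsto_lowerbound) auto
qed

section \<open>Resolvents\<close>

definition shift_mat :: "complex mat \<Rightarrow> complex \<Rightarrow> complex mat" where
  "shift_mat M z = z \<cdot>\<^sub>m 1\<^sub>m (dim_row M) + M"

(* The inverse of z I + M, so that poles are at the negatives of the eigenvalues of M. *)
definition resolvent :: "complex mat \<Rightarrow> complex \<Rightarrow> complex mat" where
  "resolvent M z = inverse (det (shift_mat M z)) \<cdot>\<^sub>m adj_mat (shift_mat M z)"

lemma shift_mat_carrier [simp]: "M \<in> carrier_mat n n \<Longrightarrow> shift_mat M z \<in> carrier_mat n n"
  by (auto simp: shift_mat_def)

lemma resolvent_carrier [simp]: "M \<in> carrier_mat n n \<Longrightarrow> resolvent M z \<in> carrier_mat n n"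
  using adj_mat(1) [OF shift_mat_carrier] by (auto simp: resolvent_def)

lemma resolvent_inverse:
  assumes M: "M \<in> carrier_mat n n" and det: "det (shift_mat M z) \<noteq> 0"
  shows "shift_mat M z * resolvent M z = 1\<^sub>m n" "resolvent M z * shift_mat M z = 1\<^sub>m n"
proof -
  note S = shift_mat_carrier [OF M, of z]
  note adj = adj_mat [OF S]
  have [simp]: "inverse (det (shift_mat M z)) \<cdot>\<^sub>m (det (shift_mat M z) \<cdot>\<^sub>m 1\<^sub>m n) = 1\<^sub>m n"
    using det by (intro eq_matI) auto
  show "shift_mat M z * resolvent M z = 1\<^sub>m n" "resolvent M z * shift_mat M z = 1\<^sub>m n"
    unfolding resolvent_def using mult_smult_distrib [OF S adj(1)] mult_smult_assoc_mat [OF adj(1) S] adj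
    by auto
qed

text \<open>A one-sided inverse suffices: the product of the determinants is 1, so the shifted
  matrix is nonsingular and its inverse cancels.\<close>

lemma resolvent_unique:
  assumes M: "M \<in> carrier_mat n n" and X: "X \<in> carrier_mat n n" and "shift_mat M z * X = 1\<^sub>m n"
  shows "det (shift_mat M z) \<noteq> 0" "X = resolvent M z"
proof -
  have "det (shift_mat M z) * det X = 1"
    using det_mult [OF shift_mat_carrier [OF M] X, of z] assms by simp
  then show det: "det (shift_mat M z) \<noteq> 0" by auto
  have "X = (resolvent M z * shift_mat M z) * X"
    using resolvent_inverse [OF M det] X by simp
  also have "\<dots> = resolvent M z"
    using assoc_mult_mat [OF resolvent_carrier [OF M] shift_mat_carrier [OF M] X, of z z] assms(3)
      right_mult_one_mat [OF resolvent_carrier [OF M, of z]] by simp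
  finally show "X = resolvent M z" .
qed

lemma holomorphic_on_det:
  assumes "\<And>z. M z \<in> carrier_mat n n"
    and "\<And>i j. i < n \<Longrightarrow> j < n \<Longrightarrow> (\<lambda>z. M z $$ (i, j)) holomorphic_on S"
  shows "(\<lambda>z. det (M z)) holomorphic_on S"
proof -
  have "(\<lambda>z. M z $$ (i, p i)) holomorphic_on S" if "p permutes {0..<n}" "i \<in> {0..<n}" for p i
    using assms(2) [of i "p i"] permutes_in_image [OF that(1), of i] that(2) by simp
  then show ?thesis
    unfolding det_def' [OF assms(1)] by (intro holomorphic_intros) auto
qed

text \<open>Cramer's rule is built into the definition of \<open>resolvent\<close>: each entry is a
  signed minor over the determinant, and both are polynomials in z. The adjugate is transposed, so
  entry (i, j) deletes row j and column i.\<close>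

lemma holomorphic_on_resolvent:
  assumes M: "M \<in> carrier_mat n n" and ij: "i < n" "j < n"
    and S: "\<And>z. z \<in> S \<Longrightarrow> det (shift_mat M z) \<noteq> 0"
  shows "(\<lambda>z. resolvent M z $$ (i, j)) holomorphic_on S"
proof -
  have shift: "(\<lambda>z. shift_mat M z $$ (i', j')) holomorphic_on S" if "i' < n" "j' < n" for i' j'
    using M that by (auto simp: shift_mat_def intro!: holomorphic_intros)
  have "(\<lambda>z. mat_delete (shift_mat M z) j i $$ (i', j')) holomorphic_on S"
    if "i' < n - 1" "j' < n - 1" for i' j'
  proof -
    have "(\<lambda>z. mat_delete (shift_mat M z) j i $$ (i', j')) = (\<lambda>z. shift_mat M z $$
        (if i' < j then i' else Suc i', if j' < i then j' else Suc j'))"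
      using M that carrier_matD [OF shift_mat_carrier [OF M]] by (auto simp: mat_delete_def)
    then show ?thesis using that by (simp only:) (rule shift; auto)
  qed
  then have "(\<lambda>z. det (mat_delete (shift_mat M z) j i)) holomorphic_on S"
    using mat_delete_carrier [OF shift_mat_carrier [OF M]] by (intro holomorphic_on_det)
  moreover have "(\<lambda>z. det (shift_mat M z)) holomorphic_on S"
    using shift M by (intro holomorphic_on_det [where n = n]) auto
  ultimately have "(\<lambda>z. inverse (det (shift_mat M z)) *
      ((-1) ^ (j + i) * det (mat_delete (shift_mat M z) j i))) holomorphic_on S"
    using S by (intro holomorphic_intros) auto
  also have "(\<lambda>z. inverse (det (shift_mat M z)) * ((-1) ^ (j + i) * det (mat_delete (shift_mat M z) j i))) =
      (\<lambda>z. resolvent M z $$ (i, j))"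
    using ij carrier_matD [OF shift_mat_carrier [OF M]]
    by (auto simp: resolvent_def adj_mat_def cofactor_def)
  finally show ?thesis .
qed

text \<open>The matrix \<open>X\<close> of entrywise sums is a right inverse of z + M by
  telescoping, and \<open>resolvent_unique\<close> then gives nonsingularity and the value of the
  resolvent at once.\<close>

lemma neumann_series:
  assumes M: "M \<in> carrier_mat n n" and ij: "i < n" "j < n"
    and B: "0 < B" "\<And>m i j. i < n \<Longrightarrow> j < n \<Longrightarrow> norm ((M ^\<^sub>m m) $$ (i, j)) \<le> B ^ m" and z: "B < norm z"
  shows "det (shift_mat M z) \<noteq> 0"
    "(\<lambda>m. (-1) ^ m * (M ^\<^sub>m m) $$ (i, j) / z ^ Suc m) sums resolvent M z $$ (i, j)"
proof -
  define c where "c = (\<lambda>i j m. (-1) ^ m * (M ^\<^sub>m m) $$ (i, j) / z ^ Suc m)"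
  define X where "X = mat n n (\<lambda>(i, j). suminf (c i j))"
  have z0: "norm z > 0" "z \<noteq> 0" using B z by auto
  have sums: "c i j sums X $$ (i, j)" if ij: "i < n" "j < n" for i j
  proof -
    have "summable (c i j)"
    proof (rule summable_comparison_test' [where N = 0])
      show "summable (\<lambda>m. (B / norm z) ^ m / norm z)"
        using B z z0 by (intro summable_divide summable_geometric) (auto simp: divide_less_eq)
      show "norm (c i j m) \<le> (B / norm z) ^ m / norm z" for m
        using B(2) [OF ij, of m] z0
        by (simp add: c_def norm_mult norm_divide norm_power field_simps mult_right_mono)
    qed
    then show ?thesis using ij by (auto simp: X_def summable_sums)
  qed
  have X: "X \<in> carrier_mat n n" by (simp add: X_def)
  have "shift_mat M z * X = 1\<^sub>m n"
  proof (rule eq_matI)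
    fix i j assume "i < dim_row (1\<^sub>m n :: complex mat)" "j < dim_col (1\<^sub>m n :: complex mat)"
    then have ij: "i < n" "j < n" by auto
    have "(\<lambda>m. z * c i j (Suc m)) sums (z * X $$ (i, j) - z * c i j 0)"
      using sums_mult [OF sums [OF ij], of z] by (subst sums_Suc_iff) auto
    moreover have "(\<lambda>m. \<Sum>k<n. M $$ (i, k) * c k j m) sums (\<Sum>k<n. M $$ (i, k) * X $$ (k, j))"
      using ij by (intro sums_sum sums_mult sums) auto
    \<comment> \<open>The telescoping: term m of M X cancels term m + 1 of z X, so that only the
      term 0 of z X, the identity matrix, is left.\<close>
    moreover have "(\<Sum>k<n. M $$ (i, k) * c k j m) = - (z * c i j (Suc m))" for m
    proof -
      have "(M ^\<^sub>m Suc m) $$ (i, j) = (\<Sum>k<n. M $$ (i, k) * (M ^\<^sub>m m) $$ (k, j))"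
        using M ij by (subst pow_mat_Suc_left) (auto simp: scalar_prod_def atLeast0LessThan)
      then show ?thesis
        using z0 by (simp add: c_def sum_distrib_left sum_divide_distrib sum_negf field_simps del: pow_mat.simps)
    qed
    ultimately have "(\<lambda>m. - (z * c i j (Suc m))) sums (\<Sum>k<n. M $$ (i, k) * X $$ (k, j))"
      "(\<lambda>m. - (z * c i j (Suc m))) sums - (z * X $$ (i, j) - z * c i j 0)"
      by (simp, intro sums_minus)
    then have "(\<Sum>k<n. M $$ (i, k) * X $$ (k, j)) = - (z * X $$ (i, j) - z * c i j 0)"
      by (rule sums_unique2)
    moreover have "z * c i j 0 = (1\<^sub>m n) $$ (i, j)" using ij M z0 by (simp add: c_def)
    moreover have "(shift_mat M z * X) $$ (i, j) = z * X $$ (i, j) + (\<Sum>k<n. M $$ (i, k) * X $$ (k, j))"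
    proof -
      have "(shift_mat M z * X) $$ (i, j) = (\<Sum>k<n. (z * (if i = k then 1 else 0) + M $$ (i, k)) * X $$ (k, j))"
        using M X ij by (auto simp: shift_mat_def scalar_prod_def atLeast0LessThan intro!: sum.cong)
      also have "\<dots> = (\<Sum>k<n. (if k = i then z * X $$ (i, j) else 0)) + (\<Sum>k<n. M $$ (i, k) * X $$ (k, j))"
        by (subst sum.distrib [symmetric], intro sum.cong) (auto simp: algebra_simps)
      finally show ?thesis using ij by simp
    qed
    ultimately show "(shift_mat M z * X) $$ (i, j) = (1\<^sub>m n) $$ (i, j)" by simp
  qed (use M X in \<open>auto simp: shift_mat_def\<close>)
  from resolvent_unique [OF M X this] sums [OF ij]
  show "det (shift_mat M z) \<noteq> 0"
    "(\<lambda>m. (-1) ^ m * (M ^\<^sub>m m) $$ (i, j) / z ^ Suc m) sums resolvent M z $$ (i, j)"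
    by (auto simp: c_def)
qed

lemma higher_deriv_exp_mult: "(deriv ^^ k) (\<lambda>z. exp (c * z)) = (\<lambda>z. c ^ k * exp (c * z :: complex))"
proof (induction k)
  case (Suc k)
  have "((\<lambda>z. c ^ k * exp (c * z)) has_field_derivative c ^ Suc k * exp (c * z)) (at z)" for z
    by (auto intro!: derivative_eq_intros)
  then have "deriv (\<lambda>z. c ^ k * exp (c * z)) = (\<lambda>z. c ^ Suc k * exp (c * z))"
    by (intro ext DERIV_imp_deriv)
  then show ?case by (simp add: Suc)
qed simp

text \<open>Inserting the Neumann series leaves exp(tz) / z^(l + m + 1), whose circle integral is 2
  pi i t^(l + m) / (l + m)! by Cauchy's formula for derivatives at 0. These are t^l times the terms
  of the series of phi_l. A radius above B + |e| puts 0 inside the circle and keeps the circle in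
  the region where the Neumann series converges.\<close>

lemma circle_integral_exp_resolvent:
  fixes t e :: real
  assumes M: "M \<in> carrier_mat n n" and ij: "i < n" "j < n"
    and sums: "(\<lambda>m. (-1) ^ m * (M ^\<^sub>m m) $$ (i, j) / fact (m + l) * of_real t ^ m) sums s"
  shows "\<forall>\<^sub>F R in at_top. ((\<lambda>z. exp (of_real t * z) / z ^ l * resolvent M z $$ (i, j))
    has_contour_integral (2 * of_real pi * \<i> * of_real t ^ l * s)) (circlepath (of_real e) R)"
proof -
  obtain B where B: "B > 0" "\<And>m i j. i < n \<Longrightarrow> j < n \<Longrightarrow> norm ((M ^\<^sub>m m) $$ (i, j)) \<le> B ^ m"
    using pow_mat_index_bound M by blast
  define g where "g = (\<lambda>m z. exp (of_real t * z) / z ^ (l + Suc m) * ((-1) ^ m * (M ^\<^sub>m m) $$ (i, j)))"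
  have "((\<lambda>z. exp (of_real t * z) / z ^ l * resolvent M z $$ (i, j))
    has_contour_integral (2 * of_real pi * \<i> * of_real t ^ l * s)) (circlepath (of_real e) R)"
    if R: "R > B + \<bar>e\<bar>" for R
  proof -
    have R0: "R > 0" using R B by linarith
    have nz: "norm z \<ge> R - \<bar>e\<bar>" "norm z > B" if "z \<in> sphere (of_real e) R" for z :: complex
    proof -
      have "R = norm (of_real e - z)" using that by (simp add: dist_norm)
      also have "\<dots> \<le> \<bar>e\<bar> + norm z"
        using norm_triangle_ineq4 [of "of_real e" z] by simp
      finally show "norm z \<ge> R - \<bar>e\<bar>" "norm z > B" using R by auto
    qed
    define L where "L = (\<lambda>z. exp (of_real t * z) / z ^ l * resolvent M z $$ (i, j))"
    have pt: "(\<lambda>m. g m z) sums L z" if "z \<in> sphere (of_real e) R" for z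
    proof -
      have "(\<lambda>m. exp (of_real t * z) / z ^ l * ((-1) ^ m * (M ^\<^sub>m m) $$ (i, j) / z ^ Suc m)) sums L z"
        unfolding L_def by (intro sums_mult neumann_series(2) [OF M ij B nz(2)] that)
      then show ?thesis by (simp add: g_def power_add mult_ac)
    qed
    have "uniform_limit (sphere (of_real e) R) (\<lambda>N z. \<Sum>m<N. g m z) (\<lambda>z. \<Sum>m. g m z) sequentially"
    proof (rule Weierstrass_m_test)
      \<comment> \<open>On the circle R - |e| <= |z| <= R + |e|. The upper bound controls the
        exponential, the lower one the powers of z; the remaining ratio B / (R - |e|) is below
        1.\<close>
      define K where "K = exp (\<bar>t\<bar> * (\<bar>e\<bar> + R)) / (R - \<bar>e\<bar>) ^ Suc l"
      show "summable (\<lambda>m. K * (B / (R - \<bar>e\<bar>)) ^ m)"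
        using B R by (intro summable_mult summable_geometric) (auto simp: divide_less_eq)
      fix m and z :: complex assume z: "z \<in> sphere (of_real e) R"
      have "norm z \<le> \<bar>e\<bar> + R"
      proof -
        have "norm (z - of_real e) = R" using z by (simp add: dist_norm norm_minus_commute)
        then show ?thesis using norm_triangle_sub [of z "of_real e"] by simp
      qed
      have "norm (exp (of_real t * z)) \<le> exp (norm (of_real t * z))" by (rule norm_exp)
      also have "\<dots> \<le> exp (\<bar>t\<bar> * (\<bar>e\<bar> + R))"
        using \<open>norm z \<le> \<bar>e\<bar> + R\<close> by (simp add: norm_mult mult_left_mono)
      finally have "norm (g m z) \<le> exp (\<bar>t\<bar> * (\<bar>e\<bar> + R)) / (R - \<bar>e\<bar>) ^ (l + Suc m) * B ^ m"
        unfolding g_def norm_mult norm_divide norm_power using nz(1) [OF z] B(1) R B(2) [OF ij, of m]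
        by (intro mult_mono frac_le power_mono) (auto intro!: mult_nonneg_nonneg divide_nonneg_nonneg)
      then show "norm (g m z) \<le> K * (B / (R - \<bar>e\<bar>)) ^ m"
        by (simp add: K_def power_add power_divide mult_ac)
    qed
    then have unif: "uniform_limit (sphere (of_real e) R) (\<lambda>N z. \<Sum>m<N. g m z) L sequentially"
      by (rule uniform_limit_cong' [THEN iffD1, rotated 2]) (use pt in \<open>auto simp: sums_iff\<close>)
    have int: "(g m has_contour_integral 2 * of_real pi * \<i> * of_real t ^ l *
        ((-1) ^ m * (M ^\<^sub>m m) $$ (i, j) / fact (m + l) * of_real t ^ m)) (circlepath (of_real e) R)" for m
    proof -
      have "((\<lambda>u. exp (of_real t * u) / (u - 0) ^ Suc (l + m)) has_contour_integral
          (2 * pi * \<i>) / fact (l + m) * (deriv ^^ (l + m)) (\<lambda>u. exp (of_real t * u)) 0) (circlepath (of_real e) R)"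
        using R B by (intro Cauchy_has_contour_integral_higher_derivative_circlepath
            holomorphic_intros continuous_intros) (auto simp: dist_norm)
      from has_contour_integral_rmul [OF this [unfolded higher_deriv_exp_mult], of "(-1) ^ m * (M ^\<^sub>m m) $$ (i, j)"] show ?thesis
        by (simp add: g_def power_add mult_ac add_ac)
    qed
    have intN: "((\<lambda>z. \<Sum>m<N. g m z) has_contour_integral (\<Sum>m<N. 2 * of_real pi * \<i> * of_real t ^ l *
        ((-1) ^ m * (M ^\<^sub>m m) $$ (i, j) / fact (m + l) * of_real t ^ m))) (circlepath (of_real e) R)" for N
      by (intro has_contour_integral_sum int) auto
    have "L contour_integrable_on circlepath (of_real e) R"
      "(\<lambda>N. contour_integral (circlepath (of_real e) R) (\<lambda>z. \<Sum>m<N. g m z))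
        \<longlonglongrightarrow> contour_integral (circlepath (of_real e) R) L"
      using contour_integral_uniform_limit_circlepath [OF always_eventually unif sequentially_bot R0] intN
      unfolding contour_integrable_on_def by blast+
    moreover have "(\<lambda>N. contour_integral (circlepath (of_real e) R) (\<lambda>z. \<Sum>m<N. g m z))
        \<longlonglongrightarrow> 2 * of_real pi * \<i> * of_real t ^ l * s"
      using sums_mult [OF sums] contour_integral_unique [OF intN] by (simp add: sums_def)
    ultimately have "(L has_contour_integral (2 * of_real pi * \<i> * of_real t ^ l * s)) (circlepath (of_real e) R)"
      using LIMSEQ_unique has_contour_integral_integral by metis
    then show ?thesis by (simp add: L_def)
  qed
  then show ?thesis
    using eventually_gt_at_top [of "B + \<bar>e\<bar>"] by (rule eventually_mono [rotated]) blast
qed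

section \<open>Scalar estimates on the vertical line: integrability and eigenvalue products\<close>

text \<open>Replaces the different scales r_j and eps by one common \<open>D\<close>, so that growth
  can be measured by powers of a single quantity.\<close>

lemma one_plus_square_div_le:
  fixes r D \<rho> :: real
  assumes "0 < r" "1 \<le> D" "r\<^sup>2 \<le> D"
  shows "(1 + \<rho>\<^sup>2) / D \<le> 1 + \<rho>\<^sup>2 / r\<^sup>2"
proof -
  have "1 / D \<le> 1" "\<rho>\<^sup>2 / D \<le> \<rho>\<^sup>2 / r\<^sup>2"
    using assms by (auto intro!: divide_left_mono mult_pos_pos)
  then show ?thesis by (simp add: add_divide_distrib)
qed

text \<open>With the common base, the exponents 1/2 of the real and 1/4 of the non-real eigenvalues
  simply add up.\<close>

lemma sigma_hat_ge:
  assumes r: "\<And>j. j < k \<Longrightarrow> 0 < r_hat \<mu> \<epsilon> j" and D: "1 \<le> D" "\<And>j. j < k \<Longrightarrow> (r_hat \<mu> \<epsilon> j)\<^sup>2 \<le> D"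
    and k2: "k2 \<le> k"
  shows "((1 + \<rho>\<^sup>2) / D) powr (real k2 / 2 + real (k - k2) / 4) \<le> sigma_hat k k2 \<mu> \<epsilon> \<rho>"
proof -
  define b where "b = (1 + \<rho>\<^sup>2) / D"
  have b: "0 < b" using D by (simp add: b_def add_pos_nonneg)
  have "b powr (real k2 / 2 + real (k - k2) / 4) = (\<Prod>j<k2. b powr (1/2)) * (\<Prod>j=k2..<k. b powr (1/4))"
    using b by (simp add: powr_add powr_power)
  also have "\<dots> \<le> sigma_hat k k2 \<mu> \<epsilon> \<rho>"
    unfolding sigma_hat_def b_def using assms
    by (intro mult_mono prod_mono conjI powr_mono2 one_plus_square_div_le prod_nonneg) auto
  finally show ?thesis by (simp add: b_def)
qed

lemma sigma_hat_pos:
  shows "0 < sigma_hat k k2 \<mu> \<epsilon> \<rho>"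
proof -
  have "0 < 1 + \<rho>\<^sup>2 / (r_hat \<mu> \<epsilon> j)\<^sup>2" for j by (simp add: add_pos_nonneg)
  then show ?thesis
    unfolding sigma_hat_def by (intro mult_pos_pos prod_pos) (metis less_irrefl powr_gt_zero)+
qed

lemma continuous_on_sigma_hat:
  shows "continuous_on UNIV (sigma_hat k k2 \<mu> \<epsilon>)"
proof -
  have "1 + \<rho>\<^sup>2 / (r_hat \<mu> \<epsilon> j)\<^sup>2 \<noteq> 0" for \<rho> j
    using add_pos_nonneg [of 1 "\<rho>\<^sup>2 / (r_hat \<mu> \<epsilon> j)\<^sup>2"] by simp
  then show ?thesis unfolding sigma_hat_def divide_inverse by (intro continuous_intros) auto
qed

text \<open>Counting powers of 1 + rho^2: \<open>sigma_hat\<close> supplies S = (k + k2) / 4 and the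
  factor with exponent l supplies l / 2. Their sum is at least 1 by \<open>size\<close>, whence a
  multiple of 1 / (1 + rho^2) is a majorant.\<close>

lemma integrable_on_sigma_hat:
  fixes l :: nat
  assumes r: "\<And>j. j < k \<Longrightarrow> 0 < r_hat \<mu> \<epsilon> j" and eps: "0 < \<epsilon>" and k2: "k2 \<le> k"
    and size: "k + k2 + 2 * l \<ge> 4"
    and int: "(\<lambda>x::real. 1 / (1 + x\<^sup>2)) integrable_on {0..}"
  shows "(\<lambda>\<rho>. (1 + \<rho>\<^sup>2 / \<epsilon>\<^sup>2) powr (- real l / 2) / sigma_hat k k2 \<mu> \<epsilon> \<rho>) integrable_on {0..}"
    (is "?G integrable_on _")
proof -
  \<comment> \<open>Chosen to dominate 1, eps^2 and every r_j^2, as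
    \<open>one_plus_square_div_le\<close> demands.\<close>
  define D where "D = 1 + \<epsilon>\<^sup>2 + (\<Sum>j<k. (r_hat \<mu> \<epsilon> j)\<^sup>2)"
  have D1: "1 \<le> D" "\<epsilon>\<^sup>2 \<le> D" by (auto simp: D_def sum_nonneg add_nonneg_nonneg)
  have Dr: "(r_hat \<mu> \<epsilon> j)\<^sup>2 \<le> D" if "j < k" for j
    using member_le_sum [of j "{..<k}" "\<lambda>j. (r_hat \<mu> \<epsilon> j)\<^sup>2"] that
    by (simp add: D_def add_nonneg_nonneg add_increasing)
  define S where "S = real k2 / 2 + real (k - k2) / 4"
  have S: "1 \<le> S + real l / 2" using size k2 by (simp add: S_def of_nat_diff field_simps)
  have pos: "0 < 1 + \<rho>\<^sup>2 / \<epsilon>\<^sup>2" for \<rho> by (simp add: add_pos_nonneg)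
  have bound: "norm (?G \<rho>) \<le> D powr (S + real l / 2) * (1 / (1 + \<rho>\<^sup>2))" for \<rho>
  proof -
    define b where "b = (1 + \<rho>\<^sup>2) / D"
    have b: "0 < b" using D1 by (simp add: b_def add_pos_nonneg)
    have "(1 + \<rho>\<^sup>2) powr 1 \<le> (1 + \<rho>\<^sup>2) powr (S + real l / 2)"
      using S by (intro powr_mono) auto
    also have "\<dots> = D powr (S + real l / 2) * b powr (S + real l / 2)"
      using D1 by (simp add: b_def powr_divide)
    finally have 1: "1 + \<rho>\<^sup>2 \<le> D powr (S + real l / 2) * b powr (S + real l / 2)"
      by (simp add: add_nonneg_nonneg)
    have "b powr (S + real l / 2) = b powr (real l / 2) * b powr S" by (simp add: powr_add)
    also have "\<dots> \<le> (1 + \<rho>\<^sup>2 / \<epsilon>\<^sup>2) powr (real l / 2) * sigma_hat k k2 \<mu> \<epsilon> \<rho>"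
      unfolding b_def S_def using D1 Dr r eps k2
      by (intro mult_mono powr_mono2 one_plus_square_div_le sigma_hat_ge) auto
    finally have "1 + \<rho>\<^sup>2 \<le> D powr (S + real l / 2) *
        ((1 + \<rho>\<^sup>2 / \<epsilon>\<^sup>2) powr (real l / 2) * sigma_hat k k2 \<mu> \<epsilon> \<rho>)"
      using 1 by (meson mult_left_mono order_trans powr_ge_zero)
    moreover have "1 / X \<le> c * (1 / Y)" if "0 < X" "0 < Y" "Y \<le> c * X" for X Y c :: real
      using that by (simp add: field_simps)
    moreover have "norm (?G \<rho>) = 1 / ((1 + \<rho>\<^sup>2 / \<epsilon>\<^sup>2) powr (real l / 2) * sigma_hat k k2 \<mu> \<epsilon> \<rho>)"
    proof -
      have "?G \<rho> \<ge> 0" using sigma_hat_pos [of k k2 \<mu> \<epsilon> \<rho>] by simp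
      then show ?thesis
        by (simp only: real_norm_def abs_of_nonneg minus_divide_left [symmetric] powr_minus_divide)
          (simp only: divide_divide_eq_left)
    qed
    moreover have "(1 + \<rho>\<^sup>2 / \<epsilon>\<^sup>2) powr (real l / 2) * sigma_hat k k2 \<mu> \<epsilon> \<rho> > 0"
      using sigma_hat_pos [of k k2 \<mu> \<epsilon> \<rho>] pos [of \<rho>] by (intro mult_pos_pos) auto
    moreover have "1 + \<rho>\<^sup>2 > 0" by (simp add: add_pos_nonneg)
    ultimately show ?thesis by presburger
  qed
  have "sigma_hat k k2 \<mu> \<epsilon> \<rho> \<noteq> 0" "1 + \<rho>\<^sup>2 / \<epsilon>\<^sup>2 \<noteq> 0" for \<rho>
    using sigma_hat_pos [of k k2 \<mu> \<epsilon> \<rho>] pos [of \<rho>] by auto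
  then have "continuous_on {0..} ?G"
    using continuous_on_subset [OF continuous_on_sigma_hat]
    by (intro continuous_intros) (use eps in auto)
  then have "?G \<in> borel_measurable (lebesgue_on {0..})"
    by (intro continuous_imp_measurable_on_sets_lebesgue) auto
  then have "?G absolutely_integrable_on {0..}"
  proof (rule measurable_bounded_by_integrable_imp_absolutely_integrable)
    show "(\<lambda>\<rho>. D powr (S + real l / 2) * (1 / (1 + \<rho>\<^sup>2))) integrable_on {0..}"
      by (intro integrable_on_mult_right int)
  qed (use bound in auto)
  then show ?thesis by (rule set_lebesgue_integral_eq_integral)
qed

(* The right-hand side is |z + \<mu>| |cnj z + \<mu>| for z = eps + i y, where p and b are the real and
   imaginary parts of eps + \<mu>. *)
lemma conjugate_factors_ge:
  fixes p b y :: real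
  assumes "0 < p"
  shows "p * sqrt (p\<^sup>2 + b\<^sup>2) * sqrt (1 + y\<^sup>2 / (p\<^sup>2 + b\<^sup>2)) \<le>
    sqrt ((p\<^sup>2 + (y + b)\<^sup>2) * (p\<^sup>2 + (b - y)\<^sup>2))"
proof -
  have r: "0 < p\<^sup>2 + b\<^sup>2" using assms by (simp add: add_pos_nonneg)
  have "p * sqrt (p\<^sup>2 + b\<^sup>2) * sqrt (1 + y\<^sup>2 / (p\<^sup>2 + b\<^sup>2)) = sqrt (p\<^sup>2 * (p\<^sup>2 + b\<^sup>2 + y\<^sup>2))"
  proof -
    have "A * (1 + y\<^sup>2 / A) = A + y\<^sup>2" if "0 < A" for A
      using that by (simp add: field_simps)
    from this [OF r] have "p\<^sup>2 + b\<^sup>2 + y\<^sup>2 = (p\<^sup>2 + b\<^sup>2) * (1 + y\<^sup>2 / (p\<^sup>2 + b\<^sup>2))" ..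
    then have "sqrt (p\<^sup>2 * (p\<^sup>2 + b\<^sup>2 + y\<^sup>2)) =
        sqrt (p\<^sup>2) * (sqrt (p\<^sup>2 + b\<^sup>2) * sqrt (1 + y\<^sup>2 / (p\<^sup>2 + b\<^sup>2)))"
      by (simp only: real_sqrt_mult [symmetric])
    then show ?thesis using assms by simp
  qed
  also have "\<dots> \<le> sqrt ((p\<^sup>2 + (y + b)\<^sup>2) * (p\<^sup>2 + (b - y)\<^sup>2))"
  proof (rule real_sqrt_le_mono)
    have "(p\<^sup>2 + (y + b)\<^sup>2) * (p\<^sup>2 + (b - y)\<^sup>2) - p\<^sup>2 * (p\<^sup>2 + b\<^sup>2 + y\<^sup>2) =
        (b\<^sup>2 - y\<^sup>2)\<^sup>2 + p\<^sup>2 * (b\<^sup>2 + y\<^sup>2)"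
      by (simp add: power2_eq_square algebra_simps)
    moreover have "\<dots> \<ge> 0" by simp
    ultimately show "p\<^sup>2 * (p\<^sup>2 + b\<^sup>2 + y\<^sup>2) \<le> (p\<^sup>2 + (y + b)\<^sup>2) * (p\<^sup>2 + (b - y)\<^sup>2)"
      by linarith
  qed
  finally show ?thesis .
qed

text \<open>The inequality fails factor by factor: for y = - Im mu_j the modulus of z + mu_j is only
  eps + Re mu_j. By \<open>cnj\<close> the whole product is the same at y and at - y, so its square
  is the product of |z + mu_j| |cnj z + mu_j|, and there each factor can be estimated. The symmetry
  acts on y, so the conjugate eigenvalues need not be matched with each other. For a real eigenvalue
  the factor estimate is an equality.\<close>

lemma omega_sigma_le_prod:
  assumes p: "\<And>j. j < k \<Longrightarrow> 0 < \<epsilon> + Re (\<mu> j)" and k2: "k2 \<le> k" "\<And>j. j < k2 \<Longrightarrow> \<mu> j \<in> \<real>"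
    and cnj: "(\<Prod>j<k. norm (Complex \<epsilon> y + \<mu> j)) = (\<Prod>j<k. norm (Complex \<epsilon> (- y) + \<mu> j))"
  shows "omega_hat k \<mu> \<epsilon> * sigma_hat k k2 \<mu> \<epsilon> y \<le> (\<Prod>j<k. norm (Complex \<epsilon> y + \<mu> j))"
proof -
  define e where "e = (\<lambda>j. if j < k2 then 1/2 else 1/4 :: real)"
  define r where "r = r_hat \<mu> \<epsilon>"
  define q where "q = (\<lambda>j. sqrt (r j * (\<epsilon> + Re (\<mu> j))) * (1 + y\<^sup>2 / (r j)\<^sup>2) powr e j)"
  have r2: "(r j)\<^sup>2 = (\<epsilon> + Re (\<mu> j))\<^sup>2 + (Im (\<mu> j))\<^sup>2" for j by (simp add: r_def r_hat_def)
  have r0: "0 < r j" if "j < k" for j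
    unfolding r_def r_hat_def using p [OF that] by (simp add: add_pos_nonneg)
  have base: "0 < 1 + y\<^sup>2 / (r j)\<^sup>2" for j by (simp add: add_pos_nonneg)
  have lhs: "omega_hat k \<mu> \<epsilon> * sigma_hat k k2 \<mu> \<epsilon> y = (\<Prod>j<k. q j)"
  proof -
    have "(\<Prod>j<k. (1 + y\<^sup>2 / (r j)\<^sup>2) powr e j) =
        (\<Prod>j<k2. (1 + y\<^sup>2 / (r j)\<^sup>2) powr e j) * (\<Prod>j=k2..<k. (1 + y\<^sup>2 / (r j)\<^sup>2) powr e j)"
      using k2(1) by (subst prod.union_disjoint [symmetric]) (auto simp: ivl_disj_un)
    also have "\<dots> = sigma_hat k k2 \<mu> \<epsilon> y"
      unfolding sigma_hat_def r_def e_def by (intro arg_cong2 [of _ _ _ _ "(*)"] prod.cong) auto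
    finally show ?thesis by (simp add: q_def prod.distrib omega_hat_def r_def)
  qed
  have factor: "(q j)\<^sup>2 \<le> norm (Complex \<epsilon> y + \<mu> j) * norm (Complex \<epsilon> (- y) + \<mu> j)" if j: "j < k" for j
  proof -
    define P where "P = \<epsilon> + Re (\<mu> j)"
    define b where "b = Im (\<mu> j)"
    have P: "0 < P" using p [OF j] by (simp add: P_def)
    have rhs: "norm (Complex \<epsilon> y + \<mu> j) * norm (Complex \<epsilon> (- y) + \<mu> j) =
        sqrt ((P\<^sup>2 + (y + b)\<^sup>2) * (P\<^sup>2 + (b - y)\<^sup>2))"
      by (simp add: cmod_def P_def b_def real_sqrt_mult)
    have "((1 + y\<^sup>2 / (r j)\<^sup>2) powr e j)\<^sup>2 = (1 + y\<^sup>2 / (r j)\<^sup>2) powr (2 * e j)"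
      using base [of j] by (simp add: powr_power)
    then have q2: "(q j)\<^sup>2 = r j * P * (1 + y\<^sup>2 / (r j)\<^sup>2) powr (2 * e j)"
      using r0 [OF j] P by (simp add: q_def power_mult_distrib P_def)
    show ?thesis
    proof (cases "j < k2")
      case True
      then have b0: "b = 0" using k2(2) by (auto simp: b_def complex_is_Real_iff)
      then have "r j = P" using P by (simp add: r_def r_hat_def P_def b_def)
      then have "(q j)\<^sup>2 = P * P * (1 + y\<^sup>2 / P\<^sup>2)"
        using True base [of j] q2 by (simp add: e_def)
      also have "\<dots> = P\<^sup>2 + y\<^sup>2" using P by (simp add: field_simps power2_eq_square)
      finally show ?thesis using b0 by (simp add: rhs)
    next
      case False
      then have "(q j)\<^sup>2 = P * r j * sqrt (1 + y\<^sup>2 / (r j)\<^sup>2)"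
        using base [of j] q2 by (simp add: e_def powr_half_sqrt mult_ac)
      also have "r j = sqrt (P\<^sup>2 + b\<^sup>2)" by (simp add: r_def r_hat_def P_def b_def)
      finally show ?thesis using conjugate_factors_ge [OF P, of b y] by (simp add: rhs)
    qed
  qed
  have "(\<Prod>j<k. q j)\<^sup>2 = (\<Prod>j<k. (q j)\<^sup>2)" by (simp add: prod_power_distrib)
  also have "\<dots> \<le> (\<Prod>j<k. norm (Complex \<epsilon> y + \<mu> j) * norm (Complex \<epsilon> (- y) + \<mu> j))"
    using factor by (intro prod_mono) auto
  also have "\<dots> = (\<Prod>j<k. norm (Complex \<epsilon> y + \<mu> j))\<^sup>2"
    using cnj by (simp add: prod.distrib power2_eq_square)
  finally show ?thesis unfolding lhs by (rule power2_le_imp_le) (simp add: prod_nonneg)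
qed

section \<open>Resolvent estimates\<close>

text \<open>The Euclidean norm, expressed by \<open>L2_set\<close> to have the Cauchy-Schwarz
  inequality for sums at hand.\<close>

definition cnorm2 :: "complex vec \<Rightarrow> real" where
  "cnorm2 x = L2_set (\<lambda>i. norm (x $ i)) {..<dim_vec x}"

lemma cnorm2_nonneg: "0 \<le> cnorm2 x"
  by (simp add: cnorm2_def L2_set_nonneg)

lemma cnorm2_conjugate [simp]: "cnorm2 (conjugate x) = cnorm2 x"
  by (simp add: cnorm2_def L2_set_def)

lemma cnorm2_pos:
  assumes "x \<in> carrier_vec n" "x \<noteq> 0\<^sub>v n"
  shows "0 < cnorm2 x"
proof -
  obtain i where "i < n" "x $ i \<noteq> 0" using assms by (auto simp: vec_eq_iff)
  then have "0 < norm (x $ i)" "norm (x $ i) \<le> cnorm2 x"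
    using assms by (auto simp: cnorm2_def intro!: member_le_L2_set)
  then show ?thesis by linarith
qed

lemma cscalar_prod_self: "x \<bullet>c x = complex_of_real ((cnorm2 x)\<^sup>2)"
  by (simp add: scalar_prod_def cnorm2_def L2_set_def sum_nonneg complex_norm_square atLeast0LessThan
      del: of_real_power)

lemma norm_scalar_prod_le:
  assumes "x \<in> carrier_vec n" "y \<in> carrier_vec n"
  shows "norm (x \<bullet> y) \<le> cnorm2 x * cnorm2 y"
proof -
  have "norm (x \<bullet> y) \<le> (\<Sum>i<n. \<bar>norm (x $ i)\<bar> * \<bar>norm (y $ i)\<bar>)"
    using assms by (auto simp: scalar_prod_def atLeast0LessThan norm_mult intro!: order_trans [OF norm_sum])
  also have "\<dots> \<le> cnorm2 x * cnorm2 y"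
    using assms L2_set_mult_ineq [of "\<lambda>i. norm (x $ i)" "\<lambda>i. norm (y $ i)" "{..<n}"]
    by (simp add: cnorm2_def)
  finally show ?thesis .
qed

lemma shift_mat_mult_vec:
  assumes "M \<in> carrier_mat n n" "x \<in> carrier_vec n"
  shows "shift_mat M z *\<^sub>v x = z \<cdot>\<^sub>v x + M *\<^sub>v x"
proof -
  have "(z \<cdot>\<^sub>m 1\<^sub>m n) *\<^sub>v x = z \<cdot>\<^sub>v x"
    using assms by (intro eq_vecI) (auto simp: scalar_prod_def sum.remove)
  then show ?thesis
    using assms add_mult_distrib_mat_vec [of "z \<cdot>\<^sub>m 1\<^sub>m n" n n M x] by (auto simp: shift_mat_def)
qed

text \<open>A sector of half-angle at most pi / 2 lies in the half-plane Re w >= a; clearing the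
  denominator of the Rayleigh quotient gives the bound.\<close>

lemma Re_numerical_range:
  assumes M: "M \<in> carrier_mat n n" and W: "numerical_range M \<subseteq> sector \<theta> a" and \<theta>: "\<theta> \<le> pi / 2"
    and x: "x \<in> carrier_vec n"
  shows "a * (cnorm2 x)\<^sup>2 \<le> Re ((M *\<^sub>v x) \<bullet>c x)"
proof (cases "x = 0\<^sub>v n")
  case True
  then show ?thesis using M by (simp add: cnorm2_def scalar_prod_def L2_set_def)
next
  case False
  define w where "w = ((M *\<^sub>v x) \<bullet>c x) / (x \<bullet>c x)"
  have "w \<in> numerical_range M" using M x False by (auto simp: numerical_range_def w_def)
  then have "\<bar>Arg (w - of_real a)\<bar> \<le> pi / 2" using W \<theta> by (auto simp: sector_def)
  then have "0 \<le> Re (w - of_real a)" by (simp only: Arg_Re_nonneg)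
  then have "a \<le> Re w" by simp
  moreover have "Re ((M *\<^sub>v x) \<bullet>c x) = Re w * (cnorm2 x)\<^sup>2"
    using cnorm2_pos [OF x False] by (simp add: w_def cscalar_prod_self del: of_real_power)
  ultimately show ?thesis by (simp add: mult_right_mono)
qed

context
  fixes M :: "complex mat" and n :: nat and \<theta> a :: real and z :: complex
  assumes M: "M \<in> carrier_mat n n" and W: "numerical_range M \<subseteq> sector \<theta> a" and \<theta>: "\<theta> \<le> pi / 2"
    and z: "0 < Re z + a"
begin

text \<open>Coercivity: the real part of ((z + M) x, x) is at least (Re z + a) ||x||^2, and
  Cauchy-Schwarz removes one factor ||x||. Both nonsingularity and the resolvent bound follow from
  this.\<close>

lemma cnorm2_shift_mat_ge:
  assumes x: "x \<in> carrier_vec n"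
  shows "(Re z + a) * cnorm2 x \<le> cnorm2 (shift_mat M z *\<^sub>v x)"
proof (cases "cnorm2 x = 0")
  case True
  then show ?thesis by (simp add: cnorm2_nonneg)
next
  case False
  then have pos: "0 < cnorm2 x" using cnorm2_nonneg [of x] by simp
  have S: "shift_mat M z *\<^sub>v x \<in> carrier_vec n"
    by (rule mult_mat_vec_carrier [OF shift_mat_carrier [OF M] x])
  have "(shift_mat M z *\<^sub>v x) \<bullet>c x = z * (x \<bullet>c x) + (M *\<^sub>v x) \<bullet>c x"
    using M x unfolding shift_mat_mult_vec [OF M x]
    by (subst add_scalar_prod_distrib [where n = n]) auto
  then have "Re ((shift_mat M z *\<^sub>v x) \<bullet>c x) = Re z * (cnorm2 x)\<^sup>2 + Re ((M *\<^sub>v x) \<bullet>c x)"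
    by (simp add: cscalar_prod_self del: of_real_power)
  then have "(Re z + a) * (cnorm2 x)\<^sup>2 \<le> Re ((shift_mat M z *\<^sub>v x) \<bullet>c x)"
    using Re_numerical_range [OF M W \<theta> x] by (simp add: distrib_right)
  also have "\<dots> \<le> norm ((shift_mat M z *\<^sub>v x) \<bullet>c x)" by (rule complex_Re_le_cmod)
  also have "\<dots> \<le> cnorm2 (shift_mat M z *\<^sub>v x) * cnorm2 x"
    using norm_scalar_prod_le [OF S, of "conjugate x"] x by simp
  finally show ?thesis using pos by (simp add: power2_eq_square)
qed

lemma det_shift_mat_nonzero: "det (shift_mat M z) \<noteq> 0"
proof
  assume "det (shift_mat M z) = 0"
  then obtain x where x: "x \<in> carrier_vec n" "x \<noteq> 0\<^sub>v n" "shift_mat M z *\<^sub>v x = 0\<^sub>v n"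
    using det_0_iff_vec_prod_zero [OF shift_mat_carrier [OF M]] by blast
  have "cnorm2 (0\<^sub>v n) = 0" by (simp add: cnorm2_def L2_set_def)
  then show False
    using cnorm2_shift_mat_ge [OF x(1)] mult_pos_pos [OF z cnorm2_pos [OF x(1,2)]] x(3) by simp
qed

lemma cnorm2_resolvent_le:
  assumes u: "u \<in> carrier_vec n"
  shows "cnorm2 (resolvent M z *\<^sub>v u) \<le> cnorm2 u / (Re z + a)"
proof -
  have R: "resolvent M z *\<^sub>v u \<in> carrier_vec n"
    by (rule mult_mat_vec_carrier [OF resolvent_carrier [OF M] u])
  have "shift_mat M z *\<^sub>v (resolvent M z *\<^sub>v u) = u"
    using assoc_mult_mat_vec [OF shift_mat_carrier [OF M] resolvent_carrier [OF M] u, of z z]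
      resolvent_inverse(1) [OF M det_shift_mat_nonzero] u by simp
  then show ?thesis
    using cnorm2_shift_mat_ge [OF R] z by (simp add: pos_le_divide_eq mult.commute)
qed

end

text \<open>From radius 2 B on, the Neumann series is dominated by a geometric series of ratio 1/2
  with first term 1 / |z|, whence the constant 2.\<close>

lemma resolvent_decay:
  assumes M: "M \<in> carrier_mat n n"
  obtains R where "R > 0" "\<And>z. R \<le> norm z \<Longrightarrow> n > 0 \<Longrightarrow> det (shift_mat M z) \<noteq> 0"
    "\<And>z i j. R \<le> norm z \<Longrightarrow> i < n \<Longrightarrow> j < n \<Longrightarrow> norm (resolvent M z $$ (i, j)) \<le> 2 / norm z"
proof -
  obtain B where B: "B > 0" "\<And>m i j. i < n \<Longrightarrow> j < n \<Longrightarrow> norm ((M ^\<^sub>m m) $$ (i, j)) \<le> B ^ m"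
    using pow_mat_index_bound M by blast
  show ?thesis
  proof
    show "2 * B > 0" using B by simp
    show "det (shift_mat M z) \<noteq> 0" if "2 * B \<le> norm z" "n > 0" for z
      using neumann_series(1) [OF M _ _ B, of 0 0] that B(1) by auto
    show "norm (resolvent M z $$ (i, j)) \<le> 2 / norm z" if z: "2 * B \<le> norm z" and ij: "i < n" "j < n" for z i j
    proof -
      have z0: "norm z > 0" "B < norm z" using z B by auto
      note sums = neumann_series(2) [OF M ij B z0(2)]
      have geo: "(\<lambda>m. (1/2) ^ m / norm z) sums (2 / norm z)"
        using sums_divide [OF geometric_sums [of "1/2 :: real"], of "norm z"] by simp
      have "norm ((-1) ^ m * (M ^\<^sub>m m) $$ (i, j) / z ^ Suc m) \<le> (1/2) ^ m / norm z" for m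
      proof -
        have "norm ((-1) ^ m * (M ^\<^sub>m m) $$ (i, j) / z ^ Suc m) \<le> B ^ m / norm z ^ Suc m"
          using B(2) [OF ij, of m] by (simp add: norm_mult norm_divide norm_power divide_right_mono)
        also have "\<dots> = (B / norm z) ^ m / norm z" by (simp add: power_divide)
        also have "\<dots> \<le> (1/2) ^ m / norm z"
          using z z0 B by (intro divide_right_mono power_mono) (auto simp: field_simps)
        finally show ?thesis .
      qed
      from norm_suminf_le [OF this sums_summable [OF geo]] show ?thesis
        using sums geo by (simp add: sums_iff)
    qed
  qed
qed

section \<open>Determinant, corner entry and intertwining of shifted matrices\<close>

lemma det_shift_mat_char_poly:
  assumes M: "M \<in> carrier_mat k k" and "char_poly M = (\<Prod>j<k. [:- \<mu> j, 1:])"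
  shows "det (shift_mat M z) = (\<Prod>j<k. z + \<mu> j)"
proof -
  have "- char_matrix M (- z) = (-1) \<cdot>\<^sub>m shift_mat M z"
    using M by (intro eq_matI) (auto simp: char_matrix_def shift_mat_def)
  then have "poly (char_poly M) (- z) = (-1) ^ k * det (shift_mat M z)"
    using char_poly_matrix [OF M, of "- z"] carrier_matD [OF shift_mat_carrier [OF M]] by simp
  moreover have "poly (char_poly M) (- z) = (\<Prod>j<k. - z - \<mu> j)"
    by (simp add: assms(2) poly_prod algebra_simps)
  moreover have "(\<Prod>j<k. - z - \<mu> j) = (-1) ^ k * (\<Prod>j<k. z + \<mu> j)"
  proof -
    have "(\<Prod>j<k. - z - \<mu> j) = (\<Prod>j<k. (-1) * (z + \<mu> j))" by (intro prod.cong) auto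
    also have "\<dots> = (\<Prod>j<k. -1) * (\<Prod>j<k. z + \<mu> j)" by (rule prod.distrib)
    finally show ?thesis by simp
  qed
  ultimately show ?thesis by simp
qed

text \<open>The determinant of a real matrix commutes with conjugation. This provides the symmetry
  in y required by \<open>omega_sigma_le_prod\<close>.\<close>

lemma det_shift_mat_cnj:
  assumes "M \<in> carrier_mat k k"
  shows "det (shift_mat (complexify M) (cnj z)) = cnj (det (shift_mat (complexify M) z))"
proof -
  interpret cnj: comm_ring_hom cnj by unfold_locales auto
  have "shift_mat (complexify M) (cnj z) = map_mat cnj (shift_mat (complexify M) z)"
    using assms by (intro eq_matI) (auto simp: shift_mat_def)
  then show ?thesis by simp
qed

text \<open>The relevant cofactor deletes the first row and the last column. What remains of a
  Hessenberg matrix is upper triangular with the subdiagonal of \<open>M\<close> on its diagonal, so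
  its determinant does not depend on z.\<close>

lemma resolvent_hessenberg_corner:
  assumes M: "M \<in> carrier_mat k k" and k: "1 \<le> k" and hess: "upper_hessenberg M"
  shows "resolvent M z $$ (k - 1, 0) = (-1) ^ (k - 1) * (\<Prod>j<k - 1. M $$ (j + 1, j)) / det (shift_mat M z)"
proof -
  note S = carrier_matD [OF shift_mat_carrier [OF M, of z]]
  define N where "N = mat_delete (shift_mat M z) 0 (k - 1)"
  have N: "N \<in> carrier_mat (k - 1) (k - 1)"
    using mat_delete_carrier [OF shift_mat_carrier [OF M]] by (simp add: N_def)
  \<comment> \<open>Deleting row 0 moves the diagonal, and with it z, strictly above the new
    diagonal.\<close>
  have idx: "N $$ (i, j) = (if j = Suc i then z else 0) + M $$ (Suc i, j)" if "i < k - 1" "j < k - 1" for i j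
    using that M S by (auto simp: N_def mat_delete_def shift_mat_def)
  have "upper_triangular N"
    using N hess M by (auto simp: upper_triangular_def idx upper_hessenberg_def)
  then have "det N = (\<Prod>i<k - 1. N $$ (i, i))"
    using N det_upper_triangular [OF _ N] by (simp add: prod_list_diag_prod atLeast0LessThan)
  also have "\<dots> = (\<Prod>j<k - 1. M $$ (j + 1, j))" by (intro prod.cong) (auto simp: idx)
  finally have "det (mat_delete (shift_mat M z) 0 (k - 1)) = (\<Prod>j<k - 1. M $$ (j + 1, j))"
    unfolding N_def .
  then show ?thesis
    using S k by (simp add: resolvent_def adj_mat_def cofactor_def divide_inverse)
qed

text \<open>The terms z V cancel, so (z + A) V = V (z + T) + U; multiply by the resolvent of A from
  the left and by that of T from the right.\<close>

lemma resolvent_intertwine: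
  assumes A: "A \<in> carrier_mat n n" and T: "T \<in> carrier_mat k k" and V: "V \<in> carrier_mat n k"
    and U: "U \<in> carrier_mat n k" and AV: "A * V = V * T + U"
    and det: "det (shift_mat A z) \<noteq> 0" "det (shift_mat T z) \<noteq> 0"
  shows "V * resolvent T z = resolvent A z * V + resolvent A z * U * resolvent T z"
proof -
  note SA = shift_mat_carrier [OF A, of z] and ST = shift_mat_carrier [OF T, of z]
  note RA = resolvent_carrier [OF A, of z] and RT = resolvent_carrier [OF T, of z]
  have VT: "V * shift_mat T z \<in> carrier_mat n k" using V ST by auto
  have "shift_mat A z * V = V * shift_mat T z + U"
  proof -
    have "shift_mat A z * V = z \<cdot>\<^sub>m V + A * V"
      using A V add_mult_distrib_mat [of "z \<cdot>\<^sub>m 1\<^sub>m n" n n A V k] mult_smult_assoc_mat [of "1\<^sub>m n" n n V k z]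
      by (auto simp: shift_mat_def)
    moreover have "V * shift_mat T z = z \<cdot>\<^sub>m V + V * T"
      using T V mult_add_distrib_mat [of V n k "z \<cdot>\<^sub>m 1\<^sub>m k" k T] mult_smult_distrib [of V n k "1\<^sub>m k" k z]
      by (auto simp: shift_mat_def)
    ultimately show ?thesis
      using V U T assoc_add_mat [of "z \<cdot>\<^sub>m V" n k "V * T" U] by (auto simp: AV)
  qed
  then have "resolvent A z * (shift_mat A z * V) = resolvent A z * (V * shift_mat T z + U)" by simp
  then have "V = resolvent A z * (V * shift_mat T z + U)"
    using assoc_mult_mat [OF RA SA V] resolvent_inverse(2) [OF A det(1)] V by simp
  also have "\<dots> = resolvent A z * (V * shift_mat T z) + resolvent A z * U"
    by (rule mult_add_distrib_mat [OF RA VT U])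
  finally have "V * resolvent T z = (resolvent A z * (V * shift_mat T z) + resolvent A z * U) * resolvent T z"
    by simp
  also have "\<dots> = resolvent A z * (V * shift_mat T z) * resolvent T z + resolvent A z * U * resolvent T z"
    using add_mult_distrib_mat [of "resolvent A z * (V * shift_mat T z)" n k "resolvent A z * U" "resolvent T z" k]
      RA RT VT U by auto
  also have "resolvent A z * (V * shift_mat T z) * resolvent T z = resolvent A z * (V * (shift_mat T z * resolvent T z))"
    using assoc_mult_mat [OF RA VT RT] assoc_mult_mat [OF V ST RT] by simp
  also have "\<dots> = resolvent A z * V"
    using resolvent_inverse(1) [OF T det(2)] V by simp
  finally show ?thesis .
qed

section \<open>The error as a contour integral\<close>

lemma scalar_prod_lessThan:
  assumes "y \<in> carrier_vec n"
  shows "x \<bullet> y = (\<Sum>i<n. x $ i * y $ i)"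
  using assms by (simp add: scalar_prod_def atLeast0LessThan)

lemma mult_mat_vec_index_lessThan:
  assumes "M \<in> carrier_mat n m" "x \<in> carrier_vec m" "i < n"
  shows "(M *\<^sub>v x) $ i = (\<Sum>j<m. M $$ (i, j) * x $ j)"
  using assms by (simp add: scalar_prod_def atLeast0LessThan)

lemma mult_mat_index_lessThan:
  assumes "M \<in> carrier_mat n m" "N \<in> carrier_mat m k" "i < n" "j < k"
  shows "(M * N) $$ (i, j) = (\<Sum>l<m. M $$ (i, l) * N $$ (l, j))"
  using assms by (simp add: scalar_prod_def atLeast0LessThan)

lemma outer_prod_carrier [simp]:
  "u \<in> carrier_vec n \<Longrightarrow> w \<in> carrier_vec m \<Longrightarrow> outer_prod u w \<in> carrier_mat n m"
  by (simp add: outer_prod_def)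

lemma mult_outer_prod:
  assumes "M \<in> carrier_mat n m" "u \<in> carrier_vec m" "w \<in> carrier_vec k"
  shows "M * outer_prod u w = outer_prod (M *\<^sub>v u) w"
  using assms
  by (intro eq_matI) (auto simp: outer_prod_def scalar_prod_def sum_distrib_right mult.assoc intro!: sum.cong)

lemma outer_prod_unit_vec_mult:
  fixes q :: "complex vec"
  assumes q: "q \<in> carrier_vec n" and M: "M \<in> carrier_mat k k" and ij: "i < n" "m < k" "j < k"
  shows "(outer_prod q (unit_vec k m) * M) $$ (i, j) = q $ i * M $$ (m, j)"
proof -
  have "(outer_prod q (unit_vec k m) * M) $$ (i, j) = (\<Sum>l<k. outer_prod q (unit_vec k m) $$ (i, l) * M $$ (l, j))"
    using q M ij by (intro mult_mat_index_lessThan) auto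
  also have "\<dots> = (\<Sum>l<k. if l = m then q $ i * M $$ (l, j) else 0)"
    using q ij by (intro sum.cong) (auto simp: outer_prod_def unit_vec_def)
  finally show ?thesis using ij by simp
qed

lemma norm2_nonneg: "0 \<le> norm2 x"
  by (simp add: norm2_def scalar_prod_def sum_nonneg)

lemma cnorm2_of_real: "cnorm2 (map_vec complex_of_real x) = norm2 x"
  by (simp add: cnorm2_def norm2_def L2_set_def scalar_prod_def power2_eq_square atLeast0LessThan)

lemma circle_integral_exp_resolvent_real:
  fixes t e :: real and M :: "real mat"
  assumes M: "M \<in> carrier_mat n n" and ij: "i < n" "j < n"
  shows "\<forall>\<^sub>F R in at_top. ((\<lambda>z. exp (of_real t * z) / z ^ l * resolvent (complexify M) z $$ (i, j))
    has_contour_integral (2 * of_real pi * \<i> * of_real t ^ l *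
      of_real (matfun (phi l) ((- t) \<cdot>\<^sub>m M) $$ (i, j)))) (circlepath (of_real e) R)"
proof (rule circle_integral_exp_resolvent [where n = n])
  have "(\<lambda>m. of_real ((-1) ^ m * (M ^\<^sub>m m) $$ (i, j) / fact (m + l) * t ^ m)) sums
      complex_of_real (matfun (phi l) ((- t) \<cdot>\<^sub>m M) $$ (i, j))"
    using matfun_phi_sums [OF M ij] by (rule sums_of_real)
  moreover have "(complexify M ^\<^sub>m m) $$ (i, j) = of_real ((M ^\<^sub>m m) $$ (i, j))" for m
    using M ij by (simp add: of_real_hom.mat_hom_pow [OF M, symmetric])
  ultimately show "(\<lambda>m. (-1) ^ m * (complexify M ^\<^sub>m m) $$ (i, j) / fact (m + l) * of_real t ^ m) sums
      complex_of_real (matfun (phi l) ((- t) \<cdot>\<^sub>m M) $$ (i, j))"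
    by simp
qed (use M ij in auto)

text \<open>The setting after the harmonic correction has been absorbed into \<open>T\<close> and
  \<open>u\<close>. The vector \<open>x\<close> is the one against which the error is tested;
  pairing with it makes all contour integrals scalar.\<close>

locale krylov_relation =
  fixes A T V :: "real mat" and u v x :: "real vec" and n k l :: nat and \<beta> \<theta> a t \<epsilon> :: real
  assumes A: "A \<in> carrier_mat n n" and T: "T \<in> carrier_mat k k" and V: "V \<in> carrier_mat n k"
    and u: "u \<in> carrier_vec n" and v: "v \<in> carrier_vec n" and x: "x \<in> carrier_vec n"
    and k: "1 \<le> k" and t: "0 < t" and \<epsilon>: "0 < \<epsilon>" and \<beta>: "0 \<le> \<beta>"
    and AV: "A * V = V * T + outer_prod u (unit_vec k (k - 1))"
    and hess: "upper_hessenberg T" and Vv: "\<And>i. i < n \<Longrightarrow> \<beta> * V $$ (i, 0) = v $ i"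
    and a: "0 \<le> a" and \<theta>: "\<theta> \<le> pi / 2"
    and WA: "numerical_range (complexify A) \<subseteq> sector \<theta> a"
    and WT: "numerical_range (complexify T) \<subseteq> sector \<theta> a"
begin

text \<open>This is x^T ((z + A)^(-1) v - beta V (z + T)^(-1) e_1), spelled out in entries so that
  holomorphy and contour integration can be handled entry by entry.\<close>

definition resolvent_error :: "complex \<Rightarrow> complex" where
  "resolvent_error z = (\<Sum>i<n. of_real (x $ i) *
     ((\<Sum>j<n. of_real (v $ j) * resolvent (complexify A) z $$ (i, j)) -
      (\<Sum>j<k. of_real (\<beta> * V $$ (i, j)) * resolvent (complexify T) z $$ (j, 0))))"

definition phi_error :: real where
  "phi_error = x \<bullet> (matfun (phi l) ((- t) \<cdot>\<^sub>m A) *\<^sub>v v -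
     V *\<^sub>v (matfun (phi l) ((- t) \<cdot>\<^sub>m T) *\<^sub>v (\<beta> \<cdot>\<^sub>v unit_vec k 0)))"

text \<open>The integrand of an inverse Laplace transform: (z + A)^(-1) / z^l is the Laplace
  transform of t^l phi_l(-tA).\<close>

definition integrand :: "complex \<Rightarrow> complex" where
  "integrand z = exp (of_real t * z) / z ^ l * resolvent_error z"

lemma cA: "complexify A \<in> carrier_mat n n" and cT: "complexify T \<in> carrier_mat k k"
  and cV: "complexify V \<in> carrier_mat n k"
  using A T V by auto

lemma det_nonzero:
  assumes "0 < Re z"
  shows "det (shift_mat (complexify A) z) \<noteq> 0" "det (shift_mat (complexify T) z) \<noteq> 0"
  using assms a by (auto intro!: det_shift_mat_nonzero [OF cA WA \<theta>] det_shift_mat_nonzero [OF cT WT \<theta>])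

lemma phi_error_eq:
  "phi_error = (\<Sum>i<n. x $ i *
     ((\<Sum>j<n. v $ j * matfun (phi l) ((- t) \<cdot>\<^sub>m A) $$ (i, j)) -
      (\<Sum>j<k. \<beta> * V $$ (i, j) * matfun (phi l) ((- t) \<cdot>\<^sub>m T) $$ (j, 0))))"
proof -
  have FA: "matfun (phi l) ((- t) \<cdot>\<^sub>m A) \<in> carrier_mat n n"
    and FT: "matfun (phi l) ((- t) \<cdot>\<^sub>m T) \<in> carrier_mat k k"
    using A T by (auto simp: matfun_def)
  define y where "y = matfun (phi l) ((- t) \<cdot>\<^sub>m T) *\<^sub>v (\<beta> \<cdot>\<^sub>v unit_vec k 0)"
  have y: "y \<in> carrier_vec k" unfolding y_def using FT by (intro mult_mat_vec_carrier [OF FT]) auto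
  have y_index: "y $ j = \<beta> * matfun (phi l) ((- t) \<cdot>\<^sub>m T) $$ (j, 0)" if "j < k" for j
    using FT k that by (simp add: y_def)
  have VT: "V *\<^sub>v y \<in> carrier_vec n" by (rule mult_mat_vec_carrier [OF V y])
  have "phi_error = (\<Sum>i<n. x $ i * ((matfun (phi l) ((- t) \<cdot>\<^sub>m A) *\<^sub>v v) $ i - (V *\<^sub>v y) $ i))"
    unfolding phi_error_def y_def [symmetric] using VT V mult_mat_vec_carrier [OF FA v]
    by (subst scalar_prod_lessThan [where n = n]) (auto simp del: index_mult_mat_vec)
  also have "\<dots> = (\<Sum>i<n. x $ i *
     ((\<Sum>j<n. v $ j * matfun (phi l) ((- t) \<cdot>\<^sub>m A) $$ (i, j)) -
      (\<Sum>j<k. \<beta> * V $$ (i, j) * matfun (phi l) ((- t) \<cdot>\<^sub>m T) $$ (j, 0))))"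
  proof (rule sum.cong [OF refl])
    fix i assume "i \<in> {..<n}"
    then have i: "i < n" by simp
    show "x $ i * ((matfun (phi l) ((- t) \<cdot>\<^sub>m A) *\<^sub>v v) $ i - (V *\<^sub>v y) $ i) = x $ i *
     ((\<Sum>j<n. v $ j * matfun (phi l) ((- t) \<cdot>\<^sub>m A) $$ (i, j)) -
      (\<Sum>j<k. \<beta> * V $$ (i, j) * matfun (phi l) ((- t) \<cdot>\<^sub>m T) $$ (j, 0)))"
      unfolding mult_mat_vec_index_lessThan [OF FA v i] mult_mat_vec_index_lessThan [OF V y i]
      by (simp add: y_index mult_ac)
  qed
  finally show ?thesis .
qed

text \<open>By linearity from the single entries. There are finitely many of them, so one radius is
  large enough for all.\<close>

lemma circle_integral_integrand:
  "\<forall>\<^sub>F R in at_top. (integrand has_contour_integral (2 * of_real pi * \<i> * of_real t ^ l * of_real phi_error))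
     (circlepath (of_real \<epsilon>) R)"
proof -
  define c where "c = 2 * complex_of_real pi * \<i> * of_real t ^ l"
  define w where "w = (\<lambda>z :: complex. exp (of_real t * z) / z ^ l)"
  have "\<forall>\<^sub>F R in at_top. \<forall>i\<in>{..<n}. \<forall>j\<in>{..<n}. ((\<lambda>z. w z * resolvent (complexify A) z $$ (i, j))
      has_contour_integral (c * of_real (matfun (phi l) ((- t) \<cdot>\<^sub>m A) $$ (i, j)))) (circlepath (of_real \<epsilon>) R)"
    unfolding w_def c_def by (intro eventually_ball_finite ballI circle_integral_exp_resolvent_real [OF A]) auto
  moreover have "\<forall>\<^sub>F R in at_top. \<forall>j\<in>{..<k}. ((\<lambda>z. w z * resolvent (complexify T) z $$ (j, 0))
      has_contour_integral (c * of_real (matfun (phi l) ((- t) \<cdot>\<^sub>m T) $$ (j, 0)))) (circlepath (of_real \<epsilon>) R)"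
    unfolding w_def c_def using k
    by (intro eventually_ball_finite ballI circle_integral_exp_resolvent_real [OF T]) auto
  ultimately show ?thesis
  proof eventually_elim
    case (elim R)
    have "((\<lambda>z. \<Sum>i<n. of_real (x $ i) *
       ((\<Sum>j<n. of_real (v $ j) * (w z * resolvent (complexify A) z $$ (i, j))) -
        (\<Sum>j<k. of_real (\<beta> * V $$ (i, j)) * (w z * resolvent (complexify T) z $$ (j, 0)))))
      has_contour_integral (\<Sum>i<n. of_real (x $ i) *
       ((\<Sum>j<n. of_real (v $ j) * (c * of_real (matfun (phi l) ((- t) \<cdot>\<^sub>m A) $$ (i, j)))) -
        (\<Sum>j<k. of_real (\<beta> * V $$ (i, j)) * (c * of_real (matfun (phi l) ((- t) \<cdot>\<^sub>m T) $$ (j, 0)))))))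
      (circlepath (of_real \<epsilon>) R)"
      using elim by (intro has_contour_integral_sum has_contour_integral_lmul has_contour_integral_diff) auto
    moreover have "(\<Sum>i<n. of_real (x $ i) *
       ((\<Sum>j<n. of_real (v $ j) * (w z * resolvent (complexify A) z $$ (i, j))) -
        (\<Sum>j<k. of_real (\<beta> * V $$ (i, j)) * (w z * resolvent (complexify T) z $$ (j, 0))))) =
      integrand z" for z
    proof -
      have "integrand z = w z * resolvent_error z" by (simp add: integrand_def w_def)
      then show ?thesis by (simp add: resolvent_error_def sum_distrib_left right_diff_distrib mult_ac)
    qed
    moreover have "(\<Sum>i<n. of_real (x $ i) *
       ((\<Sum>j<n. of_real (v $ j) * (c * of_real (matfun (phi l) ((- t) \<cdot>\<^sub>m A) $$ (i, j)))) -
        (\<Sum>j<k. of_real (\<beta> * V $$ (i, j)) * (c * of_real (matfun (phi l) ((- t) \<cdot>\<^sub>m T) $$ (j, 0)))))) =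
      c * of_real phi_error"
      by (simp add: phi_error_eq sum_distrib_left right_diff_distrib mult_ac)
    ultimately show ?case by (simp add: c_def)
  qed
qed

lemma integrand_holomorphic: "integrand holomorphic_on {z. 0 < Re z}"
  unfolding integrand_def resolvent_error_def
  by (intro holomorphic_intros holomorphic_on_resolvent [OF cA] holomorphic_on_resolvent [OF cT])
    (use det_nonzero k in auto)

text \<open>The first column of \<open>resolvent_intertwine\<close> with U = u e_k^T, where beta V
  e_1 = v. Only nonsingularity of the two shifted matrices is assumed, so the formula also holds far
  out in the left half-plane.\<close>

lemma resolvent_error_eq:
  assumes det: "det (shift_mat (complexify A) z) \<noteq> 0" "det (shift_mat (complexify T) z) \<noteq> 0"
  shows "resolvent_error z = - of_real \<beta> * (map_vec of_real x \<bullet>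
    (resolvent (complexify A) z *\<^sub>v map_vec of_real u)) * resolvent (complexify T) z $$ (k - 1, 0)"
proof -
  define cu where "cu = map_vec complex_of_real u"
  define RA where "RA = resolvent (complexify A) z"
  define RT where "RT = resolvent (complexify T) z"
  have RA: "RA \<in> carrier_mat n n" and RT: "RT \<in> carrier_mat k k" and cu: "cu \<in> carrier_vec n"
    using cA cT u by (auto simp: RA_def RT_def cu_def)
  have RAu: "RA *\<^sub>v cu \<in> carrier_vec n" by (rule mult_mat_vec_carrier [OF RA cu])
  have "complexify A * complexify V = complexify V * complexify T + outer_prod cu (unit_vec k (k - 1))"
  proof -
    have "complexify (V * T + outer_prod u (unit_vec k (k - 1))) =
        complexify (V * T) + outer_prod cu (unit_vec k (k - 1))"
      using V T u by (intro eq_matI) (auto simp: outer_prod_def cu_def unit_vec_def)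
    then show ?thesis
      by (simp add: of_real_hom.mat_hom_mult [OF A V, symmetric] of_real_hom.mat_hom_mult [OF V T, symmetric] AV)
  qed
  from resolvent_intertwine [OF cA cT cV _ this det] cu
  have inter: "complexify V * RT = RA * complexify V + RA * outer_prod cu (unit_vec k (k - 1)) * RT"
    by (simp add: RA_def RT_def)
  have "(RA * outer_prod cu (unit_vec k (k - 1)) * RT) $$ (i, 0) = (RA *\<^sub>v cu) $ i * RT $$ (k - 1, 0)"
    if i: "i < n" for i
    using outer_prod_unit_vec_mult [OF RAu RT i, of "k - 1" 0] k
      mult_outer_prod [OF RA cu, of "unit_vec k (k - 1)" k] by simp
  moreover have "(\<Sum>j<k. of_real (V $$ (i, j)) * RT $$ (j, 0)) = (complexify V * RT) $$ (i, 0)" if "i < n" for i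
    using V RT k that by (subst mult_mat_index_lessThan [where m = k]) auto
  moreover have "of_real \<beta> * (RA * complexify V) $$ (i, 0) = (\<Sum>j<n. of_real (v $ j) * RA $$ (i, j))"
    if "i < n" for i
    using V RA k that Vv by (subst mult_mat_index_lessThan [where m = n])
      (auto simp: sum_distrib_left Vv [symmetric] mult_ac intro!: sum.cong)
  moreover have "(RA * complexify V + RA * outer_prod cu (unit_vec k (k - 1)) * RT) $$ (i, 0) =
     (RA * complexify V) $$ (i, 0) + (RA * outer_prod cu (unit_vec k (k - 1)) * RT) $$ (i, 0)" if "i < n" for i
    using V RA RT k that by simp
  ultimately have "(\<Sum>j<n. of_real (v $ j) * RA $$ (i, j)) - (\<Sum>j<k. of_real (\<beta> * V $$ (i, j)) * RT $$ (j, 0)) =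
      - of_real \<beta> * (RA *\<^sub>v cu) $ i * RT $$ (k - 1, 0)" if "i < n" for i
    using that by (simp add: mult.assoc sum_distrib_left [symmetric] inter distrib_left)
  then have "resolvent_error z =
      (\<Sum>i<n. of_real (x $ i) * (- of_real \<beta> * (RA *\<^sub>v cu) $ i * RT $$ (k - 1, 0)))"
    unfolding resolvent_error_def RA_def RT_def by (intro sum.cong) auto
  also have "\<dots> = - of_real \<beta> * (\<Sum>i<n. of_real (x $ i) * (RA *\<^sub>v cu) $ i) * RT $$ (k - 1, 0)"
    by (simp add: sum_distrib_left sum_distrib_right sum_negf mult_ac)
  also have "(\<Sum>i<n. of_real (x $ i) * (RA *\<^sub>v cu) $ i) = map_vec of_real x \<bullet> (RA *\<^sub>v cu)"
    using x by (subst scalar_prod_lessThan [OF RAu]) (auto intro!: sum.cong)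
  finally show ?thesis by (simp add: RA_def RT_def cu_def)
qed

text \<open>The product form in \<open>resolvent_error_eq\<close> contains two resolvents, each of
  order 1 / |z|. For Re z <= eps the exponential is at most exp(t eps), and |z| >= 1 disposes of
  z^l.\<close>

lemma integrand_decay:
  obtains R C where "0 \<le> C" "\<And>z. R \<le> norm z \<Longrightarrow> Re z \<le> \<epsilon> \<Longrightarrow> norm (integrand z) \<le> C / norm z ^ 2"
proof -
  obtain R1 where R1: "\<And>z. R1 \<le> norm z \<Longrightarrow> n > 0 \<Longrightarrow> det (shift_mat (complexify A) z) \<noteq> 0"
    "\<And>z i j. R1 \<le> norm z \<Longrightarrow> i < n \<Longrightarrow> j < n \<Longrightarrow> norm (resolvent (complexify A) z $$ (i, j)) \<le> 2 / norm z"
    using resolvent_decay [OF cA] by metis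
  obtain R2 where R2: "\<And>z. R2 \<le> norm z \<Longrightarrow> k > 0 \<Longrightarrow> det (shift_mat (complexify T) z) \<noteq> 0"
    "\<And>z i j. R2 \<le> norm z \<Longrightarrow> i < k \<Longrightarrow> j < k \<Longrightarrow> norm (resolvent (complexify T) z $$ (i, j)) \<le> 2 / norm z"
    using resolvent_decay [OF cT] by metis
  define K where "K = (\<Sum>i<n. \<bar>x $ i\<bar> * (\<Sum>j<n. \<bar>u $ j\<bar>))"
  have K: "0 \<le> K" by (auto simp: K_def intro!: sum_nonneg mult_nonneg_nonneg)
  show ?thesis
  proof
    show "0 \<le> exp (t * \<epsilon>) * (\<beta> * (2 * K) * 2)" using K \<beta> by simp
    fix z assume z: "max (max R1 R2) 1 \<le> norm z" "Re z \<le> \<epsilon>"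
    have "norm (resolvent_error z) \<le> \<beta> * (2 / norm z * K) * (2 / norm z)"
    proof (cases "n = 0")
      \<comment> \<open>\<open>resolvent_decay\<close> gives nonsingularity only in positive
        dimension; for n = 0 the error is an empty sum.\<close>
      case True
      then show ?thesis unfolding resolvent_error_def using K \<beta> by simp
    next
      case False
      have "map_vec of_real x \<bullet> (resolvent (complexify A) z *\<^sub>v map_vec of_real u) =
          (\<Sum>i<n. of_real (x $ i) * (\<Sum>j<n. resolvent (complexify A) z $$ (i, j) * of_real (u $ j)))"
      proof -
        have R: "resolvent (complexify A) z \<in> carrier_mat n n" using cA by simp
        have cu: "map_vec complex_of_real u \<in> carrier_vec n" using u by simp
        show ?thesis
          unfolding scalar_prod_lessThan [OF mult_mat_vec_carrier [OF R cu]] using x u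
          by (intro sum.cong) (auto simp: mult_mat_vec_index_lessThan [OF R cu] simp del: index_mult_mat_vec)
      qed
      also have "norm \<dots> \<le> (\<Sum>i<n. \<bar>x $ i\<bar> * (\<Sum>j<n. 2 / norm z * \<bar>u $ j\<bar>))"
        using R1(2) z
        by (intro sum_norm_le) (auto simp: norm_mult simp del: times_divide_eq_left
              intro!: mult_left_mono sum_norm_le mult_right_mono)
      also have "\<dots> = 2 / norm z * K" by (simp add: K_def sum_distrib_left mult_ac)
      finally have "norm (map_vec of_real x \<bullet> (resolvent (complexify A) z *\<^sub>v map_vec of_real u)) \<le>
          2 / norm z * K" .
      moreover have "norm (resolvent (complexify T) z $$ (k - 1, 0)) \<le> 2 / norm z"
        using R2(2) z k by simp
      moreover have "det (shift_mat (complexify A) z) \<noteq> 0" "det (shift_mat (complexify T) z) \<noteq> 0"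
        using R1(1) R2(1) z k False by auto
      from resolvent_error_eq [OF this] have "norm (resolvent_error z) =
          \<beta> * norm (map_vec of_real x \<bullet> (resolvent (complexify A) z *\<^sub>v map_vec of_real u)) *
          norm (resolvent (complexify T) z $$ (k - 1, 0))"
        using \<beta> by (simp add: norm_mult)
      ultimately show ?thesis
        using \<beta> K by (simp only:) (intro mult_mono; simp)
    qed
    moreover have "norm (exp (of_real t * z) / z ^ l) \<le> exp (t * \<epsilon>) / 1"
      unfolding norm_divide norm_power norm_exp_eq_Re
      using z t by (intro frac_le) (auto intro!: one_le_power)
    ultimately have "norm (integrand z) \<le> exp (t * \<epsilon>) / 1 * (\<beta> * (2 / norm z * K) * (2 / norm z))"
      unfolding integrand_def norm_mult by (intro mult_mono) auto
    then show "norm (integrand z) \<le> exp (t * \<epsilon>) * (\<beta> * (2 * K) * 2) / norm z ^ 2"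
      by (simp add: power2_eq_square mult_ac)
  qed
qed

section \<open>The error estimate on the vertical line\<close>

text \<open>Otherwise z = - mu_j would have positive real part, where the numerical range makes z +
  T nonsingular, although its determinant has the factor z + mu_j = 0.\<close>

lemma eigenvalue_Re_nonneg:
  assumes "char_poly (complexify T) = (\<Prod>j<k. [:- \<mu> j, 1:])" "j < k"
  shows "0 \<le> Re (\<mu> j)"
proof (rule ccontr)
  assume "\<not> 0 \<le> Re (\<mu> j)"
  then have "det (shift_mat (complexify T) (- \<mu> j)) \<noteq> 0" by (intro det_nonzero) auto
  then show False using assms(2) by (auto simp: det_shift_mat_char_poly [OF cT assms(1)])
qed

lemma r_hat_pos:
  assumes "char_poly (complexify T) = (\<Prod>j<k. [:- \<mu> j, 1:])" "j < k"
  shows "0 < r_hat \<mu> \<epsilon> j"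
proof -
  have "0 < \<epsilon> + Re (\<mu> j)" using eigenvalue_Re_nonneg [OF assms] \<epsilon> by simp
  then show ?thesis by (simp add: r_hat_def add_pos_nonneg)
qed

text \<open>On the line |z| = eps (1 + rho^2 / eps^2)^(1/2), the resolvent of A contributes 1 / (eps
  + a), and the corner entry of the resolvent of T contributes P over \<open>omega_hat\<close> times
  \<open>sigma_hat\<close>. \<open>K\<close> collects the constants and \<open>G\<close> the
  dependence on rho. The 2 in 2 pi i cancels against the two halves of the line.\<close>

lemma phi_error_le:
  assumes eig: "char_poly (complexify T) = (\<Prod>j<k. [:- \<mu> j, 1:])"
    and k2: "k2 \<le> k" "\<And>j. j < k2 \<Longrightarrow> \<mu> j \<in> \<real>"
    and size: "k + k2 + 2 * l \<ge> 4"
    and P: "(\<Prod>j<k - 1. T $$ (j + 1, j)) = P" "0 \<le> P"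
  shows "\<bar>phi_error\<bar> \<le> exp (t * \<epsilon>) * \<beta> * P / (pi * (t * \<epsilon>) ^ l * omega_hat k \<mu> \<epsilon> * (\<epsilon> + a)) *
    integral {0..} (\<lambda>\<rho>. (1 + \<rho>\<^sup>2 / \<epsilon>\<^sup>2) powr (- real l / 2) / sigma_hat k k2 \<mu> \<epsilon> \<rho>) *
    (norm2 x * norm2 u)"
proof -
  define G where "G = (\<lambda>\<rho>. (1 + \<rho>\<^sup>2 / \<epsilon>\<^sup>2) powr (- real l / 2) / sigma_hat k k2 \<mu> \<epsilon> \<rho>)"
  define \<omega> where "\<omega> = omega_hat k \<mu> \<epsilon>"
  define K where "K = exp (t * \<epsilon>) / \<epsilon> ^ l * (\<beta> * (norm2 x * (norm2 u / (\<epsilon> + a))) * (P / \<omega>))"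
  have p: "0 < \<epsilon> + Re (\<mu> j)" if "j < k" for j
    using eigenvalue_Re_nonneg [OF eig that] \<epsilon> by simp
  note r = r_hat_pos [OF eig]
  have \<omega>: "0 < \<omega>"
    unfolding \<omega>_def omega_hat_def using p r by (intro prod_pos) simp
  have G: "G integrable_on {0..}"
    unfolding G_def
    by (rule integrable_on_sigma_hat [OF r \<epsilon> k2(1) size has_integral_integrable
          [OF has_integral_inverse_1_plus_square]])
  have line: "norm (integrand (Complex \<epsilon> y)) \<le> K * G \<bar>y\<bar>" for y
  proof -
    define z where "z = Complex \<epsilon> y"
    have z: "0 < Re z" using \<epsilon> by (simp add: z_def)
    have hess': "upper_hessenberg (complexify T)"
      using hess T by (auto simp: upper_hessenberg_def)
    have "(\<Prod>j<k - 1. complexify T $$ (j + 1, j)) = (\<Prod>j<k - 1. of_real (T $$ (j + 1, j)))"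
      using T by (intro prod.cong) auto
    then have prodT: "(\<Prod>j<k - 1. complexify T $$ (j + 1, j)) = of_real P"
      unfolding P(1) [symmetric] of_real_prod .
    have det: "det (shift_mat (complexify T) z') = (\<Prod>j<k. z' + \<mu> j)" for z'
      by (rule det_shift_mat_char_poly [OF cT eig])
    \<comment> \<open>The reflection y to - y is conjugation of z, under which the modulus of the
      determinant of the real matrix is invariant.\<close>
    have "(\<Prod>j<k. norm (Complex \<epsilon> y + \<mu> j)) = (\<Prod>j<k. norm (Complex \<epsilon> (- y) + \<mu> j))"
    proof -
      have "norm (det (shift_mat (complexify T) z)) = norm (det (shift_mat (complexify T) (cnj z)))"
        unfolding det_shift_mat_cnj [OF T] by simp
      moreover have "cnj z = Complex \<epsilon> (- y)" by (simp add: z_def complex_eq_iff)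
      ultimately show ?thesis by (simp add: det prod_norm z_def)
    qed
    from omega_sigma_le_prod [OF p k2 this]
    have "\<omega> * sigma_hat k k2 \<mu> \<epsilon> y \<le> norm (det (shift_mat (complexify T) z))"
      by (simp add: det z_def \<omega>_def prod_norm)
    then have "norm (resolvent (complexify T) z $$ (k - 1, 0)) \<le> P / (\<omega> * sigma_hat k k2 \<mu> \<epsilon> y)"
      unfolding resolvent_hessenberg_corner [OF cT k hess'] prodT
      using P mult_pos_pos [OF \<omega> sigma_hat_pos [of k k2 \<mu> \<epsilon> y]]
      by (auto simp: norm_mult norm_divide norm_power intro!: divide_left_mono mult_pos_pos)
    moreover have "norm (map_vec of_real x \<bullet> (resolvent (complexify A) z *\<^sub>v map_vec of_real u)) \<le>
        norm2 x * (norm2 u / (\<epsilon> + a))"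
    proof -
      have cu: "map_vec complex_of_real u \<in> carrier_vec n" using u by simp
      have "norm (map_vec of_real x \<bullet> (resolvent (complexify A) z *\<^sub>v map_vec of_real u)) \<le>
          cnorm2 (map_vec of_real x) * cnorm2 (resolvent (complexify A) z *\<^sub>v map_vec of_real u)"
        using x mult_mat_vec_carrier [OF resolvent_carrier [OF cA] cu] by (intro norm_scalar_prod_le) auto
      also have "\<dots> \<le> norm2 x * (norm2 u / (\<epsilon> + a))"
        using cnorm2_resolvent_le [OF cA WA \<theta> _ cu, of z] \<epsilon> a cnorm2_nonneg [of "map_vec of_real x"]
        by (auto simp: cnorm2_of_real z_def simp del: times_divide_eq_right intro!: mult_left_mono)
      finally show ?thesis .
    qed
    ultimately have err: "norm (resolvent_error z) \<le>
        \<beta> * (norm2 x * (norm2 u / (\<epsilon> + a))) * (P / (\<omega> * sigma_hat k k2 \<mu> \<epsilon> y))"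
      unfolding resolvent_error_eq [OF det_nonzero [OF z]] norm_mult
      using \<beta> \<epsilon> a norm2_nonneg [of x] norm2_nonneg [of u]
      by (intro mult_mono) (auto intro!: mult_nonneg_nonneg divide_nonneg_nonneg)
    have nz: "norm z = \<epsilon> * (1 + y\<^sup>2 / \<epsilon>\<^sup>2) powr (1/2)"
    proof -
      have "\<epsilon>\<^sup>2 + y\<^sup>2 = \<epsilon>\<^sup>2 * (1 + y\<^sup>2 / \<epsilon>\<^sup>2)" using \<epsilon> by (simp add: field_simps)
      then show ?thesis using \<epsilon> by (simp add: z_def cmod_def real_sqrt_mult powr_half_sqrt)
    qed
    have base: "0 < 1 + y\<^sup>2 / \<epsilon>\<^sup>2" by (simp add: add_pos_nonneg)
    have "norm (exp (of_real t * z) / z ^ l) = exp (t * \<epsilon>) / (\<epsilon> ^ l * (1 + y\<^sup>2 / \<epsilon>\<^sup>2) powr (real l / 2))"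
      using base unfolding norm_divide norm_power nz
      by (simp add: norm_exp_eq_Re z_def power_mult_distrib powr_power)
    also have "\<dots> = exp (t * \<epsilon>) / \<epsilon> ^ l * (1 + y\<^sup>2 / \<epsilon>\<^sup>2) powr (- real l / 2)"
      by (simp only: minus_divide_left [symmetric] powr_minus_divide) simp
    finally have "norm (integrand z) \<le> exp (t * \<epsilon>) / \<epsilon> ^ l * (1 + y\<^sup>2 / \<epsilon>\<^sup>2) powr (- real l / 2) *
        (\<beta> * (norm2 x * (norm2 u / (\<epsilon> + a))) * (P / (\<omega> * sigma_hat k k2 \<mu> \<epsilon> y)))"
      unfolding integrand_def norm_mult using err \<epsilon> by (intro mult_mono) auto
    also have "\<dots> = K * G y" by (simp add: K_def G_def mult_ac)
    \<comment> \<open>\<open>G\<close> depends on y through its square only.\<close>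
    also have "G y = G \<bar>y\<bar>" by (simp add: G_def sigma_hat_def)
    finally show ?thesis by (simp add: z_def)
  qed
  obtain C R where C: "0 \<le> C"
    and decay: "\<And>z. R \<le> norm z \<Longrightarrow> Re z \<le> \<epsilon> \<Longrightarrow> norm (integrand z) \<le> C / norm z ^ 2"
    by (rule integrand_decay) (rule that)
  have "(\<lambda>y. K * G y) integrable_on {0..}" using G by (rule integrable_on_mult_right)
  from circle_integral_le_vertical_line [OF \<epsilon> integrand_holomorphic circle_integral_integrand decay C line this]
  have "norm (2 * of_real pi * \<i> * of_real t ^ l * complex_of_real phi_error) \<le> 2 * integral {0..} (\<lambda>y. K * G y)" .
  then have "2 * (pi * t ^ l * \<bar>phi_error\<bar>) \<le> 2 * (K * integral {0..} G)"
    using t by (simp add: norm_mult norm_power)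
  then have "\<bar>phi_error\<bar> \<le> K * integral {0..} G / (pi * t ^ l)"
    using t by (simp add: pos_le_divide_eq mult_ac)
  also have "\<dots> = exp (t * \<epsilon>) * \<beta> * P / (pi * (t * \<epsilon>) ^ l * \<omega> * (\<epsilon> + a)) * integral {0..} G * (norm2 x * norm2 u)"
    by (simp add: K_def power_mult_distrib mult_ac)
  finally show ?thesis by (simp add: G_def \<omega>_def)
qed

end

section \<open>The harmonic Arnoldi approximation\<close>

lemma add_outer_prod_index:
  fixes u :: "real vec"
  assumes "M \<in> carrier_mat n k" "u \<in> carrier_vec n" "i < n" "j < k"
  shows "(M + outer_prod u (unit_vec k m)) $$ (i, j) = M $$ (i, j) + (if j = m then u $ i else 0)"
  using assms by (simp add: outer_prod_def unit_vec_def)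

text \<open>By \<open>has_deriv_matfun_phi\<close> the derivative of the approximation V q equals -
  V T q - (l / t) V q plus the multiple of v that occurs in the residual. Everything cancels except
  V T q - A V q, which is minus u times the last component of q.\<close>

lemma residual_eq:
  fixes A V T :: "real mat" and u v :: "real vec" and \<beta> t :: real
  assumes A: "A \<in> carrier_mat n n" and T: "T \<in> carrier_mat k k" and V: "V \<in> carrier_mat n k"
    and u: "u \<in> carrier_vec n" and v: "v \<in> carrier_vec n" and k: "1 \<le> k" and t: "t \<noteq> 0"
    and AV: "A * V = V * T + outer_prod u (unit_vec k (k - 1))"
    and Vv: "\<And>i. i < n \<Longrightarrow> \<beta> * V $$ (i, 0) = v $ i"
  shows "residual A v l (\<lambda>s. V *\<^sub>v (matfun (phi l) ((- s) \<cdot>\<^sub>m T) *\<^sub>v (\<beta> \<cdot>\<^sub>v unit_vec k 0))) t =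
    (- (\<beta> * matfun (phi l) ((- t) \<cdot>\<^sub>m T) $$ (k - 1, 0))) \<cdot>\<^sub>v u"
proof -
  define f where "f = (\<lambda>j s. matfun (phi l) ((- s) \<cdot>\<^sub>m T) $$ (j, 0))"
  define q where "q = (\<lambda>s. matfun (phi l) ((- s) \<cdot>\<^sub>m T) *\<^sub>v (\<beta> \<cdot>\<^sub>v unit_vec k 0))"
  have F: "matfun (phi l) ((- s) \<cdot>\<^sub>m T) \<in> carrier_mat k k" for s
    using T by (simp add: matfun_def)
  have q: "q s \<in> carrier_vec k" for s
    unfolding q_def by (intro mult_mat_vec_carrier [OF F]) auto
  have q_index: "q s $ j = \<beta> * f j s" if "j < k" for s j
    using F [of s] k that by (simp add: q_def f_def)
  have Vq: "(V *\<^sub>v q s) $ i = (\<Sum>j<k. V $$ (i, j) * (\<beta> * f j s))" if "i < n" for s i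
    unfolding mult_mat_vec_index_lessThan [OF V q that] by (simp add: q_index)
  have Tq: "T *\<^sub>v q t \<in> carrier_vec k" by (rule mult_mat_vec_carrier [OF T q])
  have AVq: "(A *\<^sub>v (V *\<^sub>v q t)) $ i = (V *\<^sub>v (T *\<^sub>v q t)) $ i + \<beta> * f (k - 1) t * u $ i" if i: "i < n" for i
  proof -
    have AVc: "A * V \<in> carrier_mat n k" using A V by simp
    have VTc: "V * T \<in> carrier_mat n k" using V T by simp
    have "(A *\<^sub>v (V *\<^sub>v q t)) $ i = ((A * V) *\<^sub>v q t) $ i"
      by (simp only: assoc_mult_mat_vec [OF A V q])
    also have "\<dots> = (\<Sum>j<k. ((V * T) $$ (i, j) + (if j = k - 1 then u $ i else 0)) * q t $ j)"
      unfolding mult_mat_vec_index_lessThan [OF AVc q i] unfolding AV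
      using add_outer_prod_index [OF VTc u i] by (intro sum.cong) auto
    also have "\<dots> = (\<Sum>j<k. (V * T) $$ (i, j) * q t $ j) + (\<Sum>j<k. if j = k - 1 then u $ i * q t $ j else 0)"
      by (subst sum.distrib [symmetric], intro sum.cong) (auto simp: distrib_right simp del: index_mult_mat(1))
    also have "(\<Sum>j<k. (V * T) $$ (i, j) * q t $ j) = (V *\<^sub>v (T *\<^sub>v q t)) $ i"
      unfolding mult_mat_vec_index_lessThan [OF VTc q i, symmetric]
      by (simp only: assoc_mult_mat_vec [OF V T q])
    finally show ?thesis using k by (simp add: q_index)
  qed
  \<comment> \<open>The coefficient of v in the residual; the value 0 covers l = 0, where that term
    is absent.\<close>
  define d where "d = (if l = 0 then 0 else 1 / (t * fact (l - 1)))"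
  have deriv_y: "deriv (\<lambda>s. (V *\<^sub>v q s) $ i) t =
      d * v $ i - (V *\<^sub>v (T *\<^sub>v q t)) $ i - real l / t * (V *\<^sub>v q t) $ i" if i: "i < n" for i
  proof -
    define D where "D = (\<lambda>j. (if j = 0 then d else 0) - (\<Sum>m<k. T $$ (j, m) * f m t) - real l / t * f j t)"
    have "(f j has_field_derivative D j) (at t)" if "j < k" for j
      using has_deriv_matfun_phi [OF T that _ t, of 0 l] k by (auto simp: f_def D_def d_def)
    then have "((\<lambda>s. \<Sum>j<k. V $$ (i, j) * (\<beta> * f j s)) has_field_derivative
        (\<Sum>j<k. V $$ (i, j) * (\<beta> * D j))) (at t)"
      by (intro DERIV_sum DERIV_cmult) auto
    then have "deriv (\<lambda>s. (V *\<^sub>v q s) $ i) t = (\<Sum>j<k. V $$ (i, j) * (\<beta> * D j))"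
      by (simp only: Vq [OF i] DERIV_imp_deriv)
    also have "\<dots> = (\<Sum>j<k. if j = 0 then d * (\<beta> * V $$ (i, j)) else 0) -
        (\<Sum>j<k. V $$ (i, j) * (T *\<^sub>v q t) $ j) - real l / t * (\<Sum>j<k. V $$ (i, j) * (\<beta> * f j t))"
    proof -
      have "(T *\<^sub>v q t) $ j = \<beta> * (\<Sum>m<k. T $$ (j, m) * f m t)" if "j < k" for j
        unfolding mult_mat_vec_index_lessThan [OF T q that]
        by (simp add: q_index sum_distrib_left mult_ac)
      then show ?thesis
        unfolding sum_distrib_left [of "real l / t"] sum_subtractf [symmetric]
        by (intro sum.cong) (auto simp: D_def algebra_simps simp del: index_mult_mat_vec)
    qed
    also have "\<dots> = d * v $ i - (V *\<^sub>v (T *\<^sub>v q t)) $ i - real l / t * (V *\<^sub>v q t) $ i"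
      unfolding Vq [OF i] mult_mat_vec_index_lessThan [OF V Tq i] using k Vv [OF i] by simp
    finally show ?thesis .
  qed
  have dims: "dim_vec (V *\<^sub>v q t) = n" "dim_vec (A *\<^sub>v (V *\<^sub>v q t)) = n"
    using V A by auto
  have "residual A v l (\<lambda>s. V *\<^sub>v q s) t = (- (\<beta> * f (k - 1) t)) \<cdot>\<^sub>v u"
    using u v dims
    by (intro eq_vecI)
      (auto simp: residual_def vec_deriv_def deriv_y AVq d_def simp del: index_mult_mat_vec dim_mult_mat_vec)
  then show ?thesis by (simp only: q_def f_def)
qed

section \<open>The harmonic correction and the final bound\<close>

lemma norm2_smult: "norm2 (c \<cdot>\<^sub>v x) = \<bar>c\<bar> * norm2 x"
proof -
  have "(c \<cdot>\<^sub>v x) \<bullet> (c \<cdot>\<^sub>v x) = c\<^sup>2 * (x \<bullet> x)"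
    by (simp add: scalar_prod_def sum_distrib_left power2_eq_square mult_ac)
  then show ?thesis by (simp add: norm2_def real_sqrt_mult)
qed

lemma norm2_square: "(norm2 x)\<^sup>2 = x \<bullet> x"
  by (simp add: norm2_def scalar_prod_def sum_nonneg)

lemma norm2_nonzero:
  assumes "x \<in> carrier_vec n" "x \<noteq> 0\<^sub>v n"
  shows "norm2 x \<noteq> 0"
  using cnorm2_pos [of "map_vec of_real x" n] assms by (auto simp: cnorm2_of_real [symmetric])

text \<open>\<open>inv_adjoint\<close> takes \<open>the\<close> of an optional inverse, so its
  dimensions are known only once the inverse exists. For a real matrix the adjoint is the transpose,
  which has the same nonzero determinant.\<close>

lemma inv_adjoint_carrier:
  fixes M :: "real mat"
  assumes M: "M \<in> carrier_mat k k" and inv: "invertible_mat M"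
  shows "inv_adjoint M \<in> carrier_mat k k"
proof -
  obtain B where MB: "M * B = 1\<^sub>m (dim_row M)" and BM: "B * M = 1\<^sub>m (dim_row B)"
    using inv by (auto simp: invertible_mat_def inverts_mat_def)
  have "dim_col (B * M) = dim_row B" "dim_col (M * B) = dim_row M" unfolding MB BM by simp_all
  then have B: "B \<in> carrier_mat k k" using M by auto
  have "det M * det B = 1" using det_mult [OF M B] MB M by simp
  then have det: "det M \<noteq> 0" by auto
  have adj: "mat_adjoint M = transpose_mat M"
    using M by (intro eq_matI) (auto simp: mat_adjoint_def mat_of_rows_def)
  have MT: "transpose_mat M \<in> carrier_mat k k" using M by simp
  have "transpose_mat M \<in> Units (ring_mat TYPE(real) k ())"
    using MT M det by (intro det_non_zero_imp_unit) (auto simp: det_transpose)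
  then obtain X where "mat_inverse (transpose_mat M) = Some X"
    using mat_inverse(1) [OF MT, where b = "()"] by blast
  then show ?thesis
    using mat_inverse(2) [OF MT] unfolding adj inv_adjoint_def by simp
qed

text \<open>Since X (e_k e_k^T) = (X e_k) e_k^T, the correction has rank at most one and affects the
  last column only; \<open>g\<close> is X e_k scaled by gamma h^2.\<close>

lemma harmonic_mat_eq:
  assumes H: "H \<in> carrier_mat k k" and inv: "invertible_mat (1\<^sub>m k + \<gamma> \<cdot>\<^sub>m H)"
  obtains g where "g \<in> carrier_vec k" "harmonic_mat k H h \<gamma> = H + outer_prod g (unit_vec k (k - 1))"
proof
  define X where "X = inv_adjoint (1\<^sub>m k + \<gamma> \<cdot>\<^sub>m H)"
  have X: "X \<in> carrier_mat k k"
    unfolding X_def using H inv by (intro inv_adjoint_carrier) auto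
  have e: "unit_vec k (k - 1) \<in> carrier_vec k" by simp
  show "(\<gamma> * h\<^sup>2) \<cdot>\<^sub>v (X *\<^sub>v unit_vec k (k - 1)) \<in> carrier_vec k"
    using mult_mat_vec_carrier [OF X e] by simp
  have "(\<gamma> * h\<^sup>2) \<cdot>\<^sub>m outer_prod (X *\<^sub>v unit_vec k (k - 1)) (unit_vec k (k - 1)) =
      outer_prod ((\<gamma> * h\<^sup>2) \<cdot>\<^sub>v (X *\<^sub>v unit_vec k (k - 1))) (unit_vec k (k - 1))"
    by (intro eq_matI) (auto simp: outer_prod_def)
  then show "harmonic_mat k H h \<gamma> =
      H + outer_prod ((\<gamma> * h\<^sup>2) \<cdot>\<^sub>v (X *\<^sub>v unit_vec k (k - 1))) (unit_vec k (k - 1))"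
    by (simp only: harmonic_mat_def X_def [symmetric] mult_outer_prod [OF X e e])
qed

theorem theorem4p5:
  fixes A V H T :: "real mat" and v w :: "real vec" and n k k2 l :: nat
    and h \<gamma> \<theta> a t \<epsilon> c :: real and \<mu> :: "nat \<Rightarrow> complex"
    and y y_hat :: "real \<Rightarrow> real vec"
  assumes A: "A \<in> carrier_mat n n" and v: "v \<in> carrier_vec n" "v \<noteq> 0\<^sub>v n"
    and t: "0 < t" and eps: "0 < \<epsilon>"
    and a: "0 \<le> a" and \<theta>: "0 \<le> \<theta>" "\<theta> \<le> pi / 2"
    and WA: "numerical_range (complexify A) \<subseteq> sector \<theta> a"
    and arnoldi: "arnoldi n A v k V w H h"
    and \<gamma>: "\<gamma> \<noteq> 0" "invertible_mat (1\<^sub>m k + \<gamma> \<cdot>\<^sub>m H)"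
    and T: "T = harmonic_mat k H h \<gamma>"
    and WT: "numerical_range (complexify T) \<subseteq> sector \<theta> a"
    and eigenvalues: "char_poly (complexify T) = (\<Prod>j<k. [:- \<mu> j, 1:])"
    and k2: "k2 \<le> k" "\<And>j. j < k2 \<Longrightarrow> \<mu> j \<in> \<real>" "\<And>j. k2 \<le> j \<Longrightarrow> j < k \<Longrightarrow> \<mu> j \<notin> \<real>"
    and size: "k + k2 + 2 * l \<ge> 4"
    and y: "y = (\<lambda>s. matfun (phi l) ((- s) \<cdot>\<^sub>m A) *\<^sub>v v)"
    and y_hat: "y_hat = (\<lambda>s. V *\<^sub>v (matfun (phi l) ((- s) \<cdot>\<^sub>m T) *\<^sub>v (norm2 v \<cdot>\<^sub>v unit_vec k 0)))"
    and nonzero: "unit_vec k (k - 1) \<bullet> (matfun (phi l) ((- t) \<cdot>\<^sub>m T) *\<^sub>v unit_vec k 0) \<noteq> 0"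
    and c: "c = exp (t * \<epsilon>) / (pi * (t * \<epsilon>) ^ l * omega_hat k \<mu> \<epsilon> * (\<epsilon> + a)) *
        ((\<Prod>j<k - 1. H $$ (j + 1, j)) /
         \<bar>unit_vec k (k - 1) \<bullet> (matfun (phi l) ((- t) \<cdot>\<^sub>m T) *\<^sub>v unit_vec k 0)\<bar>)"
  shows "norm2 (y t - y_hat t) \<le>
    c * integral {0..} (\<lambda>\<rho>. (1 + \<rho>\<^sup>2 / \<epsilon>\<^sup>2) powr (- real l / 2) / sigma_hat k k2 \<mu> \<epsilon> \<rho>) *
    norm2 (residual A v l y_hat t)"
proof -
  have k: "1 \<le> k" and V: "V \<in> carrier_mat n k" and w: "w \<in> carrier_vec n" and H: "H \<in> carrier_mat k k"
    and V0: "col V 0 = (1 / norm2 v) \<cdot>\<^sub>v v" and hessH: "upper_hessenberg H"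
    and subdiag: "\<And>j. j < k - 1 \<Longrightarrow> 0 \<le> H $$ (j + 1, j)"
    and AV: "A * V = V * H + h \<cdot>\<^sub>m outer_prod w (unit_vec k (k - 1))"
    using arnoldi by (auto simp: arnoldi_def Let_def)
  define \<beta> where "\<beta> = norm2 v"
  have \<beta>: "0 \<le> \<beta>" "\<beta> \<noteq> 0" using v norm2_nonzero by (auto simp: \<beta>_def norm2_nonneg)
  have Vv: "\<beta> * V $$ (i, 0) = v $ i" if "i < n" for i
  proof -
    have "V $$ (i, 0) = col V 0 $ i" using V k that by simp
    then show ?thesis using \<beta> v that by (simp add: V0 \<beta>_def)
  qed
  obtain g where g: "g \<in> carrier_vec k" and Tg: "T = H + outer_prod g (unit_vec k (k - 1))"
    using harmonic_mat_eq [OF H \<gamma>(2)] unfolding T by metis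
  have T_carrier: "T \<in> carrier_mat k k" using H g by (simp add: Tg)
  \<comment> \<open>All subdiagonal entries, and all entries below them, lie in columns before the
    last one. So the correction preserves the Hessenberg form and the product of the
    subdiagonal.\<close>
  have T_index: "T $$ (i, j) = H $$ (i, j)" if "i < k" "j < k - 1" for i j
    unfolding Tg using add_outer_prod_index [OF H g, of i j "k - 1"] that by simp
  have hess: "upper_hessenberg T"
    using hessH H T_carrier T_index by (auto simp: upper_hessenberg_def)
  have P: "(\<Prod>j<k - 1. T $$ (j + 1, j)) = (\<Prod>j<k - 1. H $$ (j + 1, j))"
    by (intro prod.cong) (auto simp: T_index)
  have P0: "0 \<le> (\<Prod>j<k - 1. H $$ (j + 1, j))" using subdiag by (intro prod_nonneg) auto
  define u where "u = h \<cdot>\<^sub>v w - V *\<^sub>v g"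
  have Vg: "V *\<^sub>v g \<in> carrier_vec n" by (rule mult_mat_vec_carrier [OF V g])
  have u: "u \<in> carrier_vec n" using w Vg by (simp add: u_def)
  have AVT: "A * V = V * T + outer_prod u (unit_vec k (k - 1))"
  proof -
    have e: "unit_vec k (k - 1) \<in> carrier_vec k" by simp
    have "V * T = V * H + outer_prod (V *\<^sub>v g) (unit_vec k (k - 1))"
      using mult_add_distrib_mat [OF V H outer_prod_carrier [OF g e]]
      by (simp only: Tg mult_outer_prod [OF V g e])
    then show ?thesis
      unfolding AV using V H w Vg
      by (intro eq_matI) (auto simp: outer_prod_def u_def left_diff_distrib
          simp del: index_mult_mat(1) index_mult_mat_vec)
  qed
  define e where "e = y t - y_hat t"
  have FA: "matfun (phi l) ((- t) \<cdot>\<^sub>m A) \<in> carrier_mat n n"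
    and FT: "matfun (phi l) ((- t) \<cdot>\<^sub>m T) \<in> carrier_mat k k"
    using A T_carrier by (simp_all add: matfun_def)
  have e: "e \<in> carrier_vec n"
    using V by (intro carrier_vecI) (simp add: e_def y_hat)
  define \<phi> where "\<phi> = matfun (phi l) ((- t) \<cdot>\<^sub>m T) $$ (k - 1, 0)"
  have \<phi>: "unit_vec k (k - 1) \<bullet> (matfun (phi l) ((- t) \<cdot>\<^sub>m T) *\<^sub>v unit_vec k 0) = \<phi>"
    using FT k by (simp add: \<phi>_def)
  have "residual A v l y_hat t = (- (\<beta> * \<phi>)) \<cdot>\<^sub>v u"
    unfolding y_hat \<beta>_def [symmetric] \<phi>_def
    using t by (intro residual_eq [OF A T_carrier V u v(1) k _ AVT Vv]) auto
  then have res: "norm2 (residual A v l y_hat t) = \<beta> * \<bar>\<phi>\<bar> * norm2 u"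
    using \<beta> by (simp add: norm2_smult abs_mult)
  interpret krylov_relation A T V u v e n k l \<beta> \<theta> a t \<epsilon>
    by unfold_locales (use A T_carrier V u v e k t eps \<beta> AVT hess Vv a \<theta> WA WT in auto)
  define Q where "Q = exp (t * \<epsilon>) / (pi * (t * \<epsilon>) ^ l * omega_hat k \<mu> \<epsilon> * (\<epsilon> + a))"
  define I where "I = integral {0..} (\<lambda>\<rho>. (1 + \<rho>\<^sup>2 / \<epsilon>\<^sup>2) powr (- real l / 2) / sigma_hat k k2 \<mu> \<epsilon> \<rho>)"
  define p where "p = (\<Prod>j<k - 1. H $$ (j + 1, j))"
  have "matfun (phi l) ((- t) \<cdot>\<^sub>m A) *\<^sub>v v -
      V *\<^sub>v (matfun (phi l) ((- t) \<cdot>\<^sub>m T) *\<^sub>v (\<beta> \<cdot>\<^sub>v unit_vec k 0)) = e"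
    by (simp add: e_def y y_hat \<beta>_def)
  then have "phi_error = (norm2 e)\<^sup>2" by (simp only: phi_error_def norm2_square)
  with phi_error_le [OF eigenvalues k2(1,2) size P P0]
  have "(norm2 e)\<^sup>2 \<le> Q * \<beta> * p * I * (norm2 e * norm2 u)"
    by (simp add: Q_def I_def p_def mult_ac)
  then have le: "norm2 e * norm2 e \<le> norm2 e * (Q * \<beta> * p * I * norm2 u)"
    by (simp add: power2_eq_square mult_ac)
  \<comment> \<open>The factor |phi| in the residual norm cancels the denominator of
    \<open>c\<close>.\<close>
  have rhs: "c * I * norm2 (residual A v l y_hat t) = Q * \<beta> * p * I * norm2 u"
  proof -
    have "c = Q * (p / \<bar>\<phi>\<bar>)" unfolding c \<phi> Q_def p_def ..
    moreover have "\<phi> \<noteq> 0" using nonzero unfolding \<phi> .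
    ultimately show ?thesis by (simp add: res)
  qed
  \<comment> \<open>Needed when the error vanishes: then \<open>le\<close> cannot be divided by its
    norm.\<close>
  have "0 \<le> Q * \<beta> * p * I * norm2 u"
  proof -
    have "0 \<le> omega_hat k \<mu> \<epsilon>"
      unfolding omega_hat_def r_hat_def
      using eigenvalue_Re_nonneg [OF eigenvalues] eps by (intro prod_nonneg) auto
    then have "0 \<le> Q" unfolding Q_def using t eps a by (intro divide_nonneg_nonneg mult_nonneg_nonneg) auto
    moreover have "0 \<le> I"
      unfolding I_def
    proof (rule Henstock_Kurzweil_Integration.integral_nonneg)
      show "(\<lambda>\<rho>. (1 + \<rho>\<^sup>2 / \<epsilon>\<^sup>2) powr (- real l / 2) / sigma_hat k k2 \<mu> \<epsilon> \<rho>) integrable_on {0..}"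
        by (rule integrable_on_sigma_hat [OF r_hat_pos [OF eigenvalues] eps k2(1) size
              has_integral_integrable [OF has_integral_inverse_1_plus_square]])
    qed (use sigma_hat_pos [of k k2 \<mu> \<epsilon>] in \<open>auto intro!: divide_nonneg_pos\<close>)
    ultimately show ?thesis
      using \<beta> P0 norm2_nonneg [of u] by (simp add: p_def)
  qed
  then have "norm2 e \<le> Q * \<beta> * p * I * norm2 u"
    using le norm2_nonneg [of e] by (cases "norm2 e = 0") auto
  then show ?thesis unfolding I_def [symmetric] rhs by (simp add: e_def)
qed

end
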